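(* Let $m\ge 3$ and $r$ denote integers. With $\ell_m$ and $\ell_{m,r,\ell_1}$ as defined in the context, the following hold. (1) For $m\notin\{7,9\}$ we have \[ \ell_m=\begin{cases} m-4& \text{if }m\geq 10,\\ 3& \text{if }m\in \{3,5,6\},\\ 4&\text{if }m\in\{4,8\}.\end{cases} \] (2) For $7\leq r< m-3$ we have \[ \ell_{m,r,r-1}=\left\lceil\frac{m-3}{r}\right\rceil+(r-2). \] (3) We have \begin{align*} \ell_{m,2,1}&=\left\lfloor\frac{m}{2}\right\rfloor \quad\text{for }m\geq 14,\\ \ell_{m,3,2}&=\begin{cases}m-2 & \text{for }m\geq 10 \text{ with } m \not\equiv 2 \pmod{3},\\ \frac{2m-4}{3} & \text{for }m\geq 14 \text{ with } m\equiv 2 \pmod{3}, \end{cases}\\ \ell_{m,4,3}&=\left\lceil\frac{m-2}{4}\right\rceil+2\quad\text{for }m\geq 62,\\ \ell_{m,5,4}&=\left\lceil\frac{m-3}{5}\right\rceil+3 \quad\text{for }m\geq 78,\\ \ell_{m,6,5}&=\left\lceil\frac{m-3}{6}\right\rceil+4 \quad\text{for }m\geq 93. \end{align*}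
   Context: $\mathbb{N}$ denotes the positive integers. For an integer $m\ge 3$ and $x\in\mathbb{Z}$, the generalized $m$-gonal number $P_m(x)$ is \[ P_m(x):=\frac{(m-2)x^2-(m-4)x}{2}. \] For $\boldsymbol{a}=(a_1,\dots,a_\ell)\in\mathbb{N}^{\ell}$ and $\boldsymbol{x}\in\mathbb{Z}^\ell$ set $P_{m,\boldsymbol{a}}(\boldsymbol{x}):=\sum_{j=1}^{\ell} a_j P_m(x_j)$. The sum $P_{m,\boldsymbol{a}}$ is called universal if for every $n\in\mathbb{N}$ there exists $\boldsymbol{x}\in\mathbb{Z}^\ell$ with $P_{m,\boldsymbol{a}}(\boldsymbol{x})=n$. $\ell_m$ denotes the minimal $\ell\in\mathbb{N}$ such that $\sum_{j=1}^{\ell}P_m(x_j)$ with $\boldsymbol{x}\in\mathbb{Z}^\ell$ is universal. For integers $r\ge 2$, $\ell_1\in\mathbb{N}$ and $\ell\ge \ell_1$, let $\boldsymbol{a}_{r,\ell_1,\ell}:=(1,\dots,1,r,\dots,r)\in\mathbb{N}^\ell$, where $1$ is repeated $\ell_1$ times and $r$ is repeated $\ell-\ell_1$ times. $\ell_{m,r,\ell_1}$ denotes the minimal $\ell$ (with $\ell\ge\ell_1$) such that $P_{m,\boldsymbol{a}_{r,\ell_1,\ell}}$ is universal. *)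

theory Defs
  imports Complex_Main
begin

text \<open>
  The division by two is exact (lemma \<open>two_times_polygonal\<close>), so this is the usual
  formula for generalized polygonal numbers.
\<close>

definition polygonal :: "int \<Rightarrow> int \<Rightarrow> int" where
  "polygonal m x = ((m - 2) * x\<^sup>2 - (m - 4) * x) div 2"

lemma two_times_polygonal: "2 * polygonal m x = (m - 2) * x\<^sup>2 - (m - 4) * x"
proof -
  have "even ((m - 2) * x\<^sup>2 - (m - 4) * x)"
    by (cases "even x"; cases "even m") auto
  then show ?thesis
    by (simp add: polygonal_def)
qed

text \<open>Vectors of length \<open>l\<close> are lists of length \<open>l\<close>.\<close>

definition polygonal_sum :: "int \<Rightarrow> nat list \<Rightarrow> int list \<Rightarrow> int" where
  "polygonal_sum m a x = (\<Sum>j<length a. int (a ! j) * polygonal m (x ! j))"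

definition universal :: "int \<Rightarrow> nat list \<Rightarrow> bool" where
  "universal m a \<longleftrightarrow>
    (\<forall>n::nat. n > 0 \<longrightarrow> (\<exists>x. length x = length a \<and> polygonal_sum m a x = int n))"

text \<open>
  If no length gave a universal sum, the minima below would be unspecified; an equation
  that evaluates one of them therefore includes the existence of a universal sum.
\<close>

definition ell :: "int \<Rightarrow> nat" where
  "ell m = (LEAST l. l \<ge> 1 \<and> universal m (replicate l 1))"

definition repeated_coeffs :: "nat \<Rightarrow> nat \<Rightarrow> nat \<Rightarrow> nat list" where
  "repeated_coeffs r l1 l = replicate l1 1 @ replicate (l - l1) r"

definition ell_rep :: "int \<Rightarrow> nat \<Rightarrow> nat \<Rightarrow> nat" where
  "ell_rep m r l1 = (LEAST l. l \<ge> l1 \<and> universal m (repeated_coeffs r l1 l))"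

end

theory Submission
  imports Defs
begin

text \<open>
  Writing \<open>tri x = x * (x - 1) div 2\<close>, the sum with coefficients \<open>a\<close> equals \<open>(m - 2) * T + B\<close> with
  \<open>T = (\<Sum>j. a\<^sub>j * tri x\<^sub>j)\<close> and \<open>B = (\<Sum>j. a\<^sub>j * x\<^sub>j)\<close>. By a variant of Cauchy's lemma, four
  equal coefficients realise every \<open>T \<ge> 1\<close> together with every \<open>B \<in> {-1, 1, 3, 5}\<close>; the remaining
  variables, restricted to 0 and 1, then fill a whole residue system modulo \<open>m - 2\<close>. The lower
  bounds come from small integers, below \<open>3 * (m - 2)\<close>, for which few values of the
  polygonal numbers are available.

  Cauchy's lemma rests on Gauss's theorem that each \<open>M\<close> congruent to 3 modulo 8 is a sum of three odd
  squares. This follows by showing that the number of such representations is proportional to the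
  number of odd positive solutions of \<open>a * b + b * c + c * a = M\<close>, among which there is
  \<open>(1, 1, (M - 1) div 2)\<close>: both counts satisfy the same recurrence, the first by the symmetry of the
  four squares in \<open>x\<^sup>2 + y\<^sup>2 + z\<^sup>2 + w\<^sup>2 = N\<close>, the second by an involution in the style of Liouville on
  the solutions of \<open>x\<^sup>2 + a * b + b * c + c * a = N\<close>.
\<close>

section \<open>Sums of three odd squares\<close>

definition quads :: "int \<Rightarrow> (int \<times> int \<times> int \<times> int) set" where
  "quads N = {(x, a, b, c). odd x \<and> odd a \<and> odd b \<and> odd c \<and> a > 0 \<and> b > 0 \<and> c > 0 \<and>
     x\<^sup>2 + a * b + b * c + c * a = N}"

lemma finite_bounded_squares: "finite {x::int. x\<^sup>2 \<le> N}"
proof -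
  have "\<bar>x\<bar> \<le> N" if "x\<^sup>2 \<le> N" for x
  proof -
    have "\<bar>x\<bar> \<le> \<bar>x\<bar>\<^sup>2" using self_le_power[of "\<bar>x\<bar>" 2] by (cases "x = 0") auto
    then show ?thesis using that by simp
  qed
  then have "{x::int. x\<^sup>2 \<le> N} \<subseteq> {-N..N}" by (auto simp: abs_le_iff) (metis minus_le_iff)
  then show ?thesis by (rule finite_subset) simp
qed

lemma finite_quads: "finite (quads N)"
proof -
  have "x\<^sup>2 \<le> N \<and> a \<le> N \<and> b \<le> N \<and> c \<le> N \<and> a > 0 \<and> b > 0 \<and> c > 0"
    if "(x, a, b, c) \<in> quads N" for x a b c
  proof -
    have p: "a > 0" "b > 0" "c > 0" "x\<^sup>2 + a * b + b * c + c * a = N"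
      using that by (auto simp: quads_def)
    then have "a \<le> a * b" "b \<le> b * c" "c \<le> c * a" "0 < a * b" "0 < b * c" "0 < c * a"
      by (auto simp: mult_le_cancel_left1)
    moreover have "x\<^sup>2 \<ge> 0" by simp
    ultimately show ?thesis using p by linarith
  qed
  then have "quads N \<subseteq> {x. x\<^sup>2 \<le> N} \<times> {0..N} \<times> {0..N} \<times> {0..N}"
    by fastforce
  then show ?thesis
    by (rule finite_subset) (simp add: finite_bounded_squares)
qed

text \<open>
  With \<open>k = 2 * x + a - b\<close> and \<open>d = a + b\<close> the form becomes \<open>((k - d) div 2)\<^sup>2 + b * k + c * d\<close>, where
  \<open>0 < b < d\<close>. Exchanging \<open>(k, b)\<close> with \<open>(d, c)\<close> preserves it but may violate the constraint, which
  now reads \<open>c < k\<close>; replacing \<open>c\<close> by \<open>c mod k\<close> and \<open>b\<close> by \<open>b + (c div k) * d\<close> repairs this.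
\<close>

definition flip :: "int \<times> int \<times> int \<times> int \<Rightarrow> int \<times> int \<times> int \<times> int" where
  "flip = (\<lambda>(x, a, b, c). let k = 2 * x + a - b in
     (b - x + c mod k, k - c mod k, c mod k, b + (c div k) * (a + b)))"

definition upper_quads :: "int \<Rightarrow> (int \<times> int \<times> int \<times> int) set" where
  "upper_quads N = {(x, a, b, c) \<in> quads N. 2 * x + a - b > 0}"

text \<open>The new \<open>k\<close> is \<open>a + b\<close> and the new \<open>d\<close> is
  \<open>k\<close>, so a second division, now by \<open>a + b\<close>, undoes the first one.\<close>

lemma flip_involution:
  assumes "q \<in> upper_quads N"
  shows "flip q \<in> upper_quads N" "flip (flip q) = q"
    "(\<lambda>(x, a, b, c). a + b) (flip q) = (\<lambda>(x, a, b, c). 2 * x + a - b) q"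
proof -
  obtain x a b c where q: "q = (x, a, b, c)" by (cases q) auto
  define k j r where "k = 2 * x + a - b" and "j = c div k" and "r = c mod k"
  have o: "odd x" "odd a" "odd b" "odd c" and p: "a > 0" "b > 0" "c > 0" "k > 0"
    and N: "x\<^sup>2 + a * b + b * c + c * a = N"
    using assms by (auto simp: upper_quads_def quads_def q k_def)
  have c: "c = j * k + r" by (simp add: j_def r_def)
  \<comment> \<open>As \<open>k\<close> is even and \<open>c\<close> odd, the remainder
    \<open>r\<close> is odd, hence nonzero; so the new entries \<open>k - r\<close> and
    \<open>r\<close> are both odd and positive.\<close>
  have "even k" using o by (simp add: k_def)
  then have "odd r" using o c by simp
  moreover have "0 \<le> r" "r < k" using p by (simp_all add: r_def)
  ultimately have r: "odd r" "0 < r" "r < k" by (auto simp: le_less)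
  have j: "j \<ge> 0" using p by (simp add: j_def pos_imp_zdiv_nonneg_iff)
  have fl: "flip q = (b - x + r, k - r, r, b + j * (a + b))"
    by (simp add: flip_def q k_def j_def r_def Let_def)
  have D: "2 * (b - x + r) + (k - r) - r = a + b" by (simp add: k_def)
  have "(b - x + r)\<^sup>2 + (k - r) * r + r * (b + j * (a + b)) + (b + j * (a + b)) * (k - r) = N"
    unfolding N[symmetric] c by (simp add: k_def power2_eq_square algebra_simps)
  then show "flip q \<in> upper_quads N"
    using o p r j \<open>even k\<close> D by (auto simp: upper_quads_def quads_def fl add_pos_nonneg)
  \<comment> \<open>Because \<open>0 < b < a + b\<close>, dividing the new last entry by
    \<open>a + b\<close> returns the old \<open>j\<close> and \<open>b\<close>.\<close>
  have b: "(b + j * (a + b)) div (a + b) = j" "(b + j * (a + b)) mod (a + b) = b"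
    using p by (simp_all add: div_add1_eq)
  have "flip (flip q) = (r - (b - x + r) + b, a + b - b, b, r + j * (k - r + r))"
    unfolding fl unfolding flip_def prod.case Let_def D b by simp
  then show "flip (flip q) = q" by (simp add: q c)
  show "(\<lambda>(x, a, b, c). a + b) (flip q) = (\<lambda>(x, a, b, c). 2 * x + a - b) q"
    unfolding fl by (simp add: q k_def)
qed

lemma sum_upper_quads:
  "(\<Sum>(x, a, b, c)\<in>upper_quads N. (2 * x + a - b)\<^sup>2 - (a + b)\<^sup>2) = 0"
proof -
  have "(\<Sum>q\<in>upper_quads N. ((\<lambda>(x, a, b, c). 2 * x + a - b) q)\<^sup>2) =
        (\<Sum>q\<in>upper_quads N. ((\<lambda>(x, a, b, c). a + b) q)\<^sup>2)"
    by (rule sum.reindex_bij_witness[where i = flip and j = flip])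
       (simp_all only: flip_involution)
  then show ?thesis
    by (simp add: case_prod_beta sum_subtractf)
qed

text \<open>On this wall the form factors as \<open>(x + a) * (x + a + 2 * c)\<close>, a multiple of
  8. Hence the two signs of \<open>2 * x + a - b\<close> exhaust \<open>quads N\<close>.\<close>

lemma quads_wall_empty:
  assumes "N mod 8 = 4" "(x, a, b, c) \<in> quads N"
  shows "2 * x + a - b \<noteq> 0"
proof
  assume "2 * x + a - b = 0"
  then have b: "b = 2 * x + a" by simp
  have o: "odd x" "odd a" "odd c" and N: "x\<^sup>2 + a * b + b * c + c * a = N"
    using assms(2) by (auto simp: quads_def)
  obtain y where y: "x + a = 2 * y" using o by (metis odd_even_add evenE)
  have "N = (x + a) * (x + a + 2 * c)"
    unfolding N[symmetric] b by (simp add: power2_eq_square algebra_simps)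
  also have "\<dots> = 4 * (y * (y + c))" unfolding y by (simp add: algebra_simps)
  also have "even (y * (y + c))" using o by simp
  then obtain z where "y * (y + c) = 2 * z" by (elim evenE)
  finally show False using assms(1) by simp
qed

text \<open>The summand of \<open>sum_upper_quads\<close> equals
  \<open>4 * (x\<^sup>2 - a * b) + 4 * x * (a - b)\<close>. It sums to 0 on the upper half and, by
  reflection, on the lower one; the cross term cancels under \<open>x\<close> to
  \<open>-x\<close>.\<close>

lemma sum_quads_eq_0:
  assumes "N mod 8 = 4"
  shows "(\<Sum>(x, a, b, c)\<in>quads N. x\<^sup>2 - a * b) = 0"
proof -
  let ?g = "\<lambda>(x, a, b, c). (2 * x + a - b)\<^sup>2 - (a + b)\<^sup>2 :: int"
  let ?L = "{(x, a, b, c) \<in> quads N. 2 * x + a - b < 0}"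
  have "quads N = upper_quads N \<union> ?L"
    using quads_wall_empty[OF assms] by (fastforce simp: upper_quads_def)
  then have "sum ?g (quads N) = sum ?g (upper_quads N \<union> ?L)" by simp
  also have "\<dots> = sum ?g (upper_quads N) + sum ?g ?L"
    by (rule sum.union_disjoint)
       (auto simp: upper_quads_def intro: finite_subset[OF _ finite_quads[of N]])
  also have "sum ?g ?L = sum ?g (upper_quads N)"
    by (rule sum.reindex_bij_witness[where
          i = "\<lambda>(x, a, b, c). (-x, b, a, c)" and j = "\<lambda>(x, a, b, c). (-x, b, a, c)"])
       (auto simp: upper_quads_def quads_def power2_eq_square algebra_simps)
  finally have "sum ?g (quads N) = 0" using sum_upper_quads[of N] by simp
  moreover have "sum (\<lambda>(x, a, b, c). x * (a - b)) (quads N) = sum (\<lambda>(x, a, b, c). - (x * (a - b))) (quads N)"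
    by (rule sum.reindex_bij_witness[where
          i = "\<lambda>(x, a, b, c). (-x, a, b, c)" and j = "\<lambda>(x, a, b, c). (-x, a, b, c)"])
       (auto simp: quads_def)
  then have "sum (\<lambda>(x, a, b, c). x * (a - b)) (quads N) = 0"
    by (simp add: case_prod_beta sum_negf)
  moreover have "sum ?g (quads N) =
      4 * (\<Sum>(x, a, b, c)\<in>quads N. x\<^sup>2 - a * b) + 4 * sum (\<lambda>(x, a, b, c). x * (a - b)) (quads N)"
    unfolding sum_distrib_left sum.distrib[symmetric]
    by (rule sum.cong) (auto simp: power2_eq_square algebra_simps)
  ultimately show ?thesis by simp
qed

section \<open>A recurrence fixing its solutions up to scale\<close>

text \<open>If \<open>f M\<close> counts representations of \<open>M\<close> by a ternary form, this
  says that \<open>x\<^sup>2\<close> has mean \<open>N / 4\<close> over the representations of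
  \<open>N\<close> by \<open>x\<^sup>2\<close> plus that form, \<open>x\<close> odd.\<close>

definition recurrent :: "(int \<Rightarrow> int) \<Rightarrow> bool" where
  "recurrent f \<longleftrightarrow> (\<forall>N. N mod 8 = 4 \<longrightarrow> (\<Sum>x | odd x \<and> x\<^sup>2 \<le> N. (4 * x\<^sup>2 - N) * f (N - x\<^sup>2)) = 0)"

lemma recurrentI:
  fixes A :: "int \<Rightarrow> (int \<times> int \<times> int) set"
  assumes "\<And>M. finite (A M)" "\<And>M. M < 0 \<Longrightarrow> A M = {}"
    and "\<And>N. N mod 8 = 4 \<Longrightarrow> (\<Sum>(x, t)\<in>{(x, t). odd x \<and> t \<in> A (N - x\<^sup>2)}. 4 * x\<^sup>2 - N) = 0"
  shows "recurrent (\<lambda>M. int (card (A M)))"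
  unfolding recurrent_def
proof (intro allI impI)
  fix N :: int assume N: "N mod 8 = 4"
  have "(\<Sum>x | odd x \<and> x\<^sup>2 \<le> N. (4 * x\<^sup>2 - N) * int (card (A (N - x\<^sup>2)))) =
     (\<Sum>x | odd x \<and> x\<^sup>2 \<le> N. \<Sum>t\<in>A (N - x\<^sup>2). 4 * x\<^sup>2 - N)"
    by (simp add: mult.commute)
  also have "\<dots> = (\<Sum>(x, t)\<in>(SIGMA x:{x. odd x \<and> x\<^sup>2 \<le> N}. A (N - x\<^sup>2)). 4 * x\<^sup>2 - N)"
    by (rule sum.Sigma) (auto intro: finite_subset[OF _ finite_bounded_squares[of N]] assms(1))
  also have "(SIGMA x:{x. odd x \<and> x\<^sup>2 \<le> N}. A (N - x\<^sup>2)) = {(x, t). odd x \<and> t \<in> A (N - x\<^sup>2)}"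
    using assms(2)[of "N - _\<^sup>2"] by (auto simp: not_le[symmetric])
  also have "(\<Sum>(x, t)\<in>{(x, t). odd x \<and> t \<in> A (N - x\<^sup>2)}. 4 * x\<^sup>2 - N) = 0"
    by (rule assms(3)[OF N])
  finally show "(\<Sum>x | odd x \<and> x\<^sup>2 \<le> N. (4 * x\<^sup>2 - N) * int (card (A (N - x\<^sup>2)))) = 0" .
qed

lemma odd_square_mod_8: "odd x \<Longrightarrow> x\<^sup>2 mod 8 = (1::int)"
proof -
  assume "odd x"
  then obtain y where x: "x = 2 * y + 1" by (elim oddE)
  have "even (y * (y + 1))" by simp
  then obtain z where "y * (y + 1) = 2 * z" by (elim evenE)
  then have "x\<^sup>2 = 8 * z + 1" by (simp add: x power2_eq_square algebra_simps)
  then show ?thesis by simp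
qed

text \<open>At \<open>N = M + 1\<close> the terms \<open>x = 1\<close> and \<open>x = -1\<close>
  contribute \<open>2 * (3 - M)\<close> times the value at \<open>M\<close>; all others involve
  smaller arguments, again 3 modulo 8. So beyond 3 each value is determined by earlier ones.\<close>

lemma recurrent_unique:
  assumes "recurrent f" "recurrent g" "g 3 = 1"
    and "M mod 8 = 3" "M > 0"
  shows "f M = f 3 * g M"
  using assms(4,5)
proof (induction "nat M" arbitrary: M rule: less_induct)
  case less
  show ?case
  proof (cases "M = 3")
    case False
    let ?X = "{x::int. odd x \<and> x\<^sup>2 \<le> M + 1}" and ?h = "\<lambda>K. f K - f 3 * g K"
    have fin: "finite ?X" by (rule finite_subset[OF _ finite_bounded_squares[of "M + 1"]]) auto
    have sub: "{-1, 1} \<subseteq> ?X" using less.prems by auto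
    have N: "(M + 1) mod 8 = 4" using less.prems by presburger
    have "0 = (\<Sum>x\<in>?X. (4 * x\<^sup>2 - (M + 1)) * f (M + 1 - x\<^sup>2)) - f 3 * (\<Sum>x\<in>?X. (4 * x\<^sup>2 - (M + 1)) * g (M + 1 - x\<^sup>2))"
      using assms(1,2) N by (simp add: recurrent_def)
    also have "\<dots> = (\<Sum>x\<in>?X. (4 * x\<^sup>2 - (M + 1)) * ?h (M + 1 - x\<^sup>2))"
      unfolding sum_distrib_left sum_subtractf[symmetric] by (rule sum.cong) (auto simp: algebra_simps)
    also have "\<dots> = (\<Sum>x\<in>{-1, 1}. (4 * x\<^sup>2 - (M + 1)) * ?h (M + 1 - x\<^sup>2))"
    proof (rule sum.mono_neutral_right[OF fin sub], rule ballI)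
      fix x assume x: "x \<in> ?X - {-1, 1}"
      then have 8: "x\<^sup>2 mod 8 = 1" by (auto intro: odd_square_mod_8)
      then have "(M + 1 - x\<^sup>2) mod 8 = 3" using less.prems by presburger
      moreover have "x\<^sup>2 \<noteq> 1" "x\<^sup>2 \<noteq> 0" using x 8 by (auto simp: power2_eq_1_iff)
      then have "x\<^sup>2 > 1" using zero_le_power2[of x] by linarith
      moreover have "x\<^sup>2 \<le> M + 1" using x by auto
      ultimately have "?h (M + 1 - x\<^sup>2) = 0"
        using less.hyps[of "M + 1 - x\<^sup>2"] by (cases "M + 1 - x\<^sup>2 = 0") auto
      then show "(4 * x\<^sup>2 - (M + 1)) * ?h (M + 1 - x\<^sup>2) = 0" by simp
    qed
    also have "\<dots> = 2 * (3 - M) * ?h M" by simp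
    finally show ?thesis using False by simp
  qed (simp add: assms(3))
qed

section \<open>Two solutions of the recurrence\<close>

definition odd_triples :: "int \<Rightarrow> (int \<times> int \<times> int) set" where
  "odd_triples M = {(y, z, w). odd y \<and> odd z \<and> odd w \<and> y\<^sup>2 + z\<^sup>2 + w\<^sup>2 = M}"

definition product_triples :: "int \<Rightarrow> (int \<times> int \<times> int) set" where
  "product_triples M = {(a, b, c). odd a \<and> odd b \<and> odd c \<and> a > 0 \<and> b > 0 \<and> c > 0 \<and>
     a * b + b * c + c * a = M}"

lemma finite_odd_triples: "finite (odd_triples M)"
proof (rule finite_subset)
  let ?S = "{x::int. x\<^sup>2 \<le> M}"
  show "odd_triples M \<subseteq> ?S \<times> ?S \<times> ?S"
    by (auto simp: odd_triples_def)
  show "finite (?S \<times> ?S \<times> ?S)" by (simp add: finite_bounded_squares)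
qed

lemma finite_product_triples: "finite (product_triples M)"
proof (rule finite_subset)
  show "product_triples M \<subseteq> (\<lambda>(x, t). t) ` quads (M + 1)"
    by (auto simp: product_triples_def quads_def intro!: image_eqI[where x = "(1, _)"])
qed (simp add: finite_quads)

text \<open>Here \<open>4 * x\<^sup>2 - N\<close> is
  \<open>3 * x\<^sup>2 - y\<^sup>2 - z\<^sup>2 - w\<^sup>2\<close>, and exchanging coordinates shows
  that the four squares have equal sums.\<close>

lemma recurrent_odd_triples: "recurrent (\<lambda>M. int (card (odd_triples M)))"
proof (rule recurrentI)
  fix M :: int assume "M < 0"
  then show "odd_triples M = {}"
    using zero_le_power2 by (auto simp: odd_triples_def) (smt (verit) zero_le_power2)
next
  fix N :: int
  let ?S = "{(x, t). odd x \<and> t \<in> odd_triples (N - x\<^sup>2)}"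
  let ?s = "\<lambda>f :: int \<times> int \<times> int \<times> int \<Rightarrow> int. sum f ?S"
  have y: "?s (\<lambda>(x, y, z, w). x\<^sup>2) = ?s (\<lambda>(x, y, z, w). y\<^sup>2)"
    by (rule sum.reindex_bij_witness[where
          i = "\<lambda>(x, y, z, w). (y, x, z, w)" and j = "\<lambda>(x, y, z, w). (y, x, z, w)"])
       (auto simp: odd_triples_def)
  have z: "?s (\<lambda>(x, y, z, w). x\<^sup>2) = ?s (\<lambda>(x, y, z, w). z\<^sup>2)"
    by (rule sum.reindex_bij_witness[where
          i = "\<lambda>(x, y, z, w). (z, y, x, w)" and j = "\<lambda>(x, y, z, w). (z, y, x, w)"])
       (auto simp: odd_triples_def)
  have w: "?s (\<lambda>(x, y, z, w). x\<^sup>2) = ?s (\<lambda>(x, y, z, w). w\<^sup>2)"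
    by (rule sum.reindex_bij_witness[where
          i = "\<lambda>(x, y, z, w). (w, y, z, x)" and j = "\<lambda>(x, y, z, w). (w, y, z, x)"])
       (auto simp: odd_triples_def)
  have "(\<Sum>(x, t)\<in>?S. 4 * x\<^sup>2 - N) = ?s (\<lambda>(x, y, z, w). 3 * x\<^sup>2 - y\<^sup>2 - z\<^sup>2 - w\<^sup>2)"
    by (rule sum.cong) (auto simp: odd_triples_def)
  also have "\<dots> = 3 * ?s (\<lambda>(x, y, z, w). x\<^sup>2) - ?s (\<lambda>(x, y, z, w). y\<^sup>2)
      - ?s (\<lambda>(x, y, z, w). z\<^sup>2) - ?s (\<lambda>(x, y, z, w). w\<^sup>2)"
    by (simp add: case_prod_beta sum_subtractf sum_distrib_left)
  finally show "(\<Sum>(x, t)\<in>?S. 4 * x\<^sup>2 - N) = 0" using y z w by simp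
qed (rule finite_odd_triples)

text \<open>Here \<open>4 * x\<^sup>2 - N\<close> splits into \<open>x\<^sup>2 - a * b\<close> and
  its two cyclic rotations, each with the sum computed in \<open>sum_quads_eq_0\<close>.\<close>

lemma recurrent_product_triples: "recurrent (\<lambda>M. int (card (product_triples M)))"
proof (rule recurrentI)
  fix M :: int assume "M < 0"
  then show "product_triples M = {}"
    using mult_pos_pos by (auto simp: product_triples_def) (smt (verit) mult_pos_pos)
next
  fix N :: int assume N: "N mod 8 = 4"
  let ?s = "\<lambda>f :: int \<times> int \<times> int \<times> int \<Rightarrow> int. sum f (quads N)"
  have S: "{(x, t). odd x \<and> t \<in> product_triples (N - x\<^sup>2)} = quads N"
    by (auto simp: product_triples_def quads_def)
  have bc: "?s (\<lambda>(x, a, b, c). x\<^sup>2 - a * b) = ?s (\<lambda>(x, a, b, c). x\<^sup>2 - b * c)"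
    by (rule sum.reindex_bij_witness[where
          i = "\<lambda>(x, a, b, c). (x, b, c, a)" and j = "\<lambda>(x, a, b, c). (x, c, a, b)"])
       (auto simp: quads_def algebra_simps)
  have ca: "?s (\<lambda>(x, a, b, c). x\<^sup>2 - a * b) = ?s (\<lambda>(x, a, b, c). x\<^sup>2 - c * a)"
    by (rule sum.reindex_bij_witness[where
          i = "\<lambda>(x, a, b, c). (x, c, a, b)" and j = "\<lambda>(x, a, b, c). (x, b, c, a)"])
       (auto simp: quads_def algebra_simps)
  have "?s (\<lambda>(x, t). 4 * x\<^sup>2 - N) = ?s (\<lambda>(x, a, b, c). (x\<^sup>2 - a * b) + (x\<^sup>2 - b * c) + (x\<^sup>2 - c * a))"
    by (rule sum.cong) (auto simp: quads_def)
  also have "\<dots> = ?s (\<lambda>(x, a, b, c). x\<^sup>2 - a * b) + ?s (\<lambda>(x, a, b, c). x\<^sup>2 - b * c)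
      + ?s (\<lambda>(x, a, b, c). x\<^sup>2 - c * a)"
    unfolding sum.distrib[symmetric] by (rule sum.cong) auto
  finally have "?s (\<lambda>(x, t). 4 * x\<^sup>2 - N) = 0"
    using bc ca sum_quads_eq_0[OF N] by simp
  then show "(\<Sum>(x, t)\<in>{(x, t). odd x \<and> t \<in> product_triples (N - x\<^sup>2)}. 4 * x\<^sup>2 - N) = 0"
    by (simp add: S)
qed (rule finite_product_triples)

theorem three_odd_squares:
  fixes M :: int
  assumes "M mod 8 = 3" "M > 0"
  obtains y z w where "odd y" "odd z" "odd w" "M = y\<^sup>2 + z\<^sup>2 + w\<^sup>2"
proof -
  \<comment> \<open>This is the normalisation \<open>g 3 = 1\<close> of
    \<open>recurrent_unique\<close>.\<close>
  have "product_triples 3 = {(1, 1, 1)}"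
  proof -
    have "a = 1 \<and> b = 1 \<and> c = 1"
      if "a > 0" "b > 0" "c > 0" "a * b + b * c + c * a = 3" for a b c :: int
    proof -
      have "a * b > 0" "b * c > 0" "c * a > 0" using that by simp_all
      then have "a * b = 1" "b * c = 1" "c * a = 1" using that(4) by linarith+
      then show ?thesis using that by (auto simp: zmult_eq_1_iff)
    qed
    then show ?thesis by (auto simp: product_triples_def)
  qed
  then have "int (card (odd_triples M)) = int (card (odd_triples 3)) * int (card (product_triples M))"
    using recurrent_unique[OF recurrent_odd_triples recurrent_product_triples _ assms] by simp
  moreover have "(1, 1, 1) \<in> odd_triples 3" by (simp add: odd_triples_def)
  then have "card (odd_triples 3) > 0" using finite_odd_triples by (auto simp: card_gt_0_iff)
  moreover have "(1, 1, (M - 1) div 2) \<in> product_triples M"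
  proof -
    have "1 + 2 * ((M - 1) div 2) = M" "odd ((M - 1) div 2)" "(M - 1) div 2 > 0"
      using assms by presburger+
    then show ?thesis by (simp add: product_triples_def)
  qed
  then have "card (product_triples M) > 0" using finite_product_triples by (auto simp: card_gt_0_iff)
  ultimately have "card (odd_triples M) > 0" by (metis nat_0_less_mult_iff of_nat_eq_iff of_nat_mult)
  then obtain t where "t \<in> odd_triples M" by (metis card.empty ex_in_conv less_irrefl)
  then show ?thesis using that by (auto simp: odd_triples_def)
qed

section \<open>Cauchy's lemma and representations by polygonal sums\<close>

definition tri :: "int \<Rightarrow> int" where
  "tri x = x * (x - 1) div 2"

lemma two_times_tri: "2 * tri x = x * (x - 1)"
  by (simp add: tri_def)

lemma tri_simps [simp]:
  "tri (-2) = 3" "tri (-1) = 1" "tri 0 = 0" "tri 1 = 0" "tri 2 = 1" "tri 3 = 3"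
  by (simp_all add: tri_def)

lemma polygonal_eq: "polygonal m x = (m - 2) * tri x + x"
proof -
  have "2 * polygonal m x = (m - 2) * (2 * tri x) + 2 * x"
    unfolding two_times_polygonal two_times_tri by (simp add: power2_eq_square algebra_simps)
  then show ?thesis by simp
qed

text \<open>Cauchy's lemma: with \<open>A = 2 * T + B\<close> the sum of the squares,
  \<open>4 * A - B\<^sup>2 = 8 * T + 4 - (B - 2)\<^sup>2\<close> is 3 modulo 8 because \<open>B\<close> is odd.\<close>

lemma cauchy_lemma:
  fixes T B :: int
  assumes "odd B" "(B - 2)\<^sup>2 \<le> 8 * T + 4"
  obtains x1 x2 x3 x4 where "tri x1 + tri x2 + tri x3 + tri x4 = T" "x1 + x2 + x3 + x4 = B"
proof -
  define M where "M = 8 * T + 4 - (B - 2)\<^sup>2"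
  have "(B - 2)\<^sup>2 mod 8 = 1" using assms(1) by (intro odd_square_mod_8) simp
  then have M: "M mod 8 = 3" unfolding M_def by presburger
  moreover from this have "M > 0" using assms(2) by (cases "M = 0") (auto simp: M_def)
  ultimately obtain u v w where o: "odd u" "odd v" "odd w" and uvw: "M = u\<^sup>2 + v\<^sup>2 + w\<^sup>2"
    by (rule three_odd_squares)
  \<comment> \<open>A sum of four odd numbers is even, and replacing \<open>w\<close> by
    \<open>-w\<close> changes it by 2 modulo 4.\<close>
  have "\<exists>w'. w'\<^sup>2 = w\<^sup>2 \<and> odd w' \<and> (B + u + v + w') mod 4 = 0"
  proof (cases "(B + u + v + w) mod 4 = 0")
    case False
    then have "(B + u + v + (-w)) mod 4 = 0" using o assms(1) by presburger
    then show ?thesis using o by (intro exI[of _ "-w"]) auto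
  qed (use o in auto)
  then obtain w' where w': "w'\<^sup>2 = w\<^sup>2" "odd w'" "4 dvd B + u + v + w'"
    by (auto simp: dvd_eq_mod_eq_0)
  from w'(3) obtain x1 where "B + u + v + w' = 4 * x1" by (elim dvdE)
  then have B: "B = 4 * x1 - u - v - w'" by linarith
  \<comment> \<open>The solution consists of \<open>(B + u + v + w') / 4\<close>,
    \<open>(B + u - v - w') / 4\<close>, \<open>(B - u + v - w') / 4\<close> and
    \<open>(B - u - v + w') / 4\<close>; the last three are \<open>x1\<close> minus a half-sum of
    two of \<open>u\<close>, \<open>v\<close>, \<open>w'\<close>.\<close>
  have "even (v + w')" "even (u + w')" using o w'(2) by simp_all
  then obtain p q where p: "v + w' = 2 * p" and q: "u + w' = 2 * q" by (elim evenE)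
  define s where "s = p + q - w'"
  have s: "u + v = 2 * s" using p q by (simp add: s_def)
  have u: "u = q + s - p" and v: "v = p + s - q" and w: "w' = p + q - s" using p q s by linarith+
  have B': "B = 4 * x1 - p - q - s" using B u v w by linarith
  have M': "M = (q + s - p)\<^sup>2 + (p + s - q)\<^sup>2 + (p + q - s)\<^sup>2"
    using uvw w'(1) u v w by simp
  have t: "8 * tri y = 4 * (y * (y - 1))" for y
    using two_times_tri[of y] by simp
  have "8 * tri x1 + 8 * tri (x1 - p) + 8 * tri (x1 - q) + 8 * tri (x1 - s) = 8 * T"
    using M' unfolding M_def B' t by (simp add: power2_eq_square algebra_simps)
  then have "tri x1 + tri (x1 - p) + tri (x1 - q) + tri (x1 - s) = T" by simp
  then show ?thesis
    using B' by (intro that[of x1 "x1 - p" "x1 - q" "x1 - s"]) simp_all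
qed

text \<open>\<open>rep a T B\<close> expresses that the polygonal sum with coefficients \<open>a\<close> takes the value
  \<open>(m - 2) * T + B\<close> at some point, in a way that is uniform in \<open>m\<close>.\<close>

inductive rep :: "nat list \<Rightarrow> int \<Rightarrow> int \<Rightarrow> bool" where
  Nil: "rep [] 0 0"
| Cons: "rep a T B \<Longrightarrow> rep (c # a) (int c * tri x + T) (int c * x + B)"

lemma polygonal_sum_Cons:
  "polygonal_sum m (c # a) (y # x) = int c * polygonal m y + polygonal_sum m a x"
  by (simp add: polygonal_sum_def sum.lessThan_Suc_shift del: sum.lessThan_Suc)

lemma rep_polygonal_sum:
  assumes "rep a T B"
  shows "\<exists>x. length x = length a \<and> polygonal_sum m a x = (m - 2) * T + B"
  using assms
proof induction
  case Nil
  show ?case by (simp add: polygonal_sum_def)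
next
  case (Cons a T B c y)
  then obtain x where "length x = length a" "polygonal_sum m a x = (m - 2) * T + B" by blast
  then show ?case
    by (intro exI[of _ "y # x"]) (simp add: polygonal_sum_Cons polygonal_eq algebra_simps)
qed

lemma universalI:
  assumes "\<And>n. n > 0 \<Longrightarrow> \<exists>T B. rep a T B \<and> n = (m - 2) * T + B"
  shows "universal m a"
  unfolding universal_def using assms rep_polygonal_sum by (metis of_nat_0_less_iff)

lemma rep_append:
  assumes "rep a T B" "rep b T' B'"
  shows "rep (a @ b) (T + T') (B + B')"
  using assms(1)
proof induction
  case (Cons a T B c x)
  from rep.Cons[OF Cons.IH, of c x] show ?case by (simp add: add.assoc)
qed (simp add: assms(2))

lemma rep_ConsI:
  "rep a (T - int c * tri x) (B - int c * x) \<Longrightarrow> rep (c # a) T B"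
  using rep.Cons[of a "T - int c * tri x" "B - int c * x" c x] by simp

text \<open>Since \<open>tri\<close> vanishes at 0 and 1, taking \<open>s\<close> variables equal to
  1 and the others 0 leaves the first component at 0.\<close>

lemma rep_zero_one:
  assumes "0 \<le> s" "s \<le> int k"
  shows "rep (replicate k r) 0 (int r * s)"
  using assms
proof (induction k arbitrary: s)
  case 0
  then show ?case by (simp add: rep.Nil)
next
  case (Suc k)
  show ?case
  proof (cases "s = 0")
    case True
    then show ?thesis using Suc.IH[of 0] rep_ConsI[of "replicate k r" 0 r 0 0] by simp
  next
    case False
    then show ?thesis
      using Suc.IH[of "s - 1"] Suc.prems rep_ConsI[of "replicate k r" 0 r 1 "int r * s"]
      by (simp add: algebra_simps)
  qed
qed

lemma rep_four:
  "rep (replicate 4 r) (int r * (tri x1 + tri x2 + tri x3 + tri x4)) (int r * (x1 + x2 + x3 + x4))"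
proof -
  have "rep [r, r, r, r] (int r * tri x1 + (int r * tri x2 + (int r * tri x3 + (int r * tri x4 + 0))))
      (int r * x1 + (int r * x2 + (int r * x3 + (int r * x4 + 0))))"
    by (intro rep.intros)
  then show ?thesis by (simp add: numeral_eq_Suc algebra_simps)
qed

lemma rep_four_odd:
  assumes "odd B" "(B - 2)\<^sup>2 \<le> 8 * T + 4"
  shows "rep (replicate 4 r) (int r * T) (int r * B)"
  using cauchy_lemma[OF assms] rep_four by metis

text \<open>Four variables give each \<open>B'\<close> among -1, 1, 3, 5, because
  \<open>(B' - 2)\<^sup>2 \<le> 9\<close>. The other \<open>k - 4\<close> variables add anything
  from 0 to \<open>k - 4\<close>; there is at least one, so the gaps close, and the reach ends at
  \<open>5 + (k - 4)\<close>.\<close>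

lemma rep_five:
  assumes "k \<ge> 5" "T \<ge> 1" "-1 \<le> B" "B \<le> int k + 1"
  shows "rep (replicate k r) (int r * T) (int r * B)"
proof -
  have *: "rep (replicate k r) (int r * T) (int r * B)"
    if "B' \<in> {-1, 1, 3, 5}" "0 \<le> B - B'" "B - B' \<le> int k - 4" for B'
  proof -
    have "odd B'" "(B' - 2)\<^sup>2 \<le> 9" using that(1) by auto
    then have "rep (replicate 4 r) (int r * T) (int r * B')"
      using assms(2) by (intro rep_four_odd) auto
    moreover have "rep (replicate (k - 4) r) 0 (int r * (B - B'))"
      using that assms(1) by (intro rep_zero_one) (auto simp: of_nat_diff)
    ultimately show ?thesis
      using rep_append[of "replicate 4 r" _ _ "replicate (k - 4) r"] assms(1)
      by (fastforce simp: replicate_add[symmetric] distrib_left[symmetric])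
  qed
  consider "B + 1 \<le> int k - 4" | "B \<ge> 1" "B - 1 \<le> int k - 4" | "B \<ge> 3" "B - 3 \<le> int k - 4"
    | "B \<ge> 5" "B - 5 \<le> int k - 4"
    using assms by linarith
  then show ?thesis
    using assms(3) *[of "-1"] *[of 1] *[of 3] *[of 5] by cases auto
qed

lemma rep_mult:
  assumes "k \<ge> 5" "T = 0 \<and> 0 \<le> B \<and> B \<le> int k \<or> T \<ge> 1 \<and> -1 \<le> B \<and> B \<le> int k + 1"
  shows "rep (replicate k r) (int r * T) (int r * B)"
  using assms rep_five rep_zero_one by auto

section \<open>Evaluation of sums and small polygonal numbers\<close>

lemma polygonal_sum_append:
  assumes "length x = length a"
  shows "polygonal_sum m (a @ b) (x @ y) = polygonal_sum m a x + polygonal_sum m b y"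
  using assms
proof (induction a arbitrary: x)
  case Nil
  then show ?case by (simp add: polygonal_sum_def)
next
  case (Cons c a)
  then show ?case by (cases x) (simp_all add: polygonal_sum_Cons)
qed

lemma polygonal_sum_replicate:
  assumes "length x = k"
  shows "polygonal_sum m (replicate k r) x = int r * (\<Sum>y\<leftarrow>x. polygonal m y)"
  using assms
proof (induction k arbitrary: x)
  case 0
  then show ?case by (simp add: polygonal_sum_def)
next
  case (Suc k)
  then show ?case by (cases x) (simp_all add: polygonal_sum_Cons algebra_simps)
qed

lemma universal_appendD:
  assumes "universal m (replicate l 1 @ replicate k r)" "n > 0"
  obtains x y where "length x = l" "length y = k"
    "(\<Sum>z\<leftarrow>x. polygonal m z) + int r * (\<Sum>z\<leftarrow>y. polygonal m z) = n"
proof -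
  have "nat n > 0" using assms(2) by simp
  with assms(1) obtain x where
    x: "length x = l + k" "polygonal_sum m (replicate l 1 @ replicate k r) x = int (nat n)"
    unfolding universal_def length_append length_replicate by blast
  have "x = take l x @ drop l x" by simp
  then have "polygonal_sum m (replicate l 1) (take l x) + polygonal_sum m (replicate k r) (drop l x) = n"
    using x assms(2) polygonal_sum_append[of "take l x" "replicate l 1" m "replicate k r" "drop l x"]
    by simp
  then show ?thesis
    using that[of "take l x" "drop l x"] x(1) polygonal_sum_replicate[of "take l x" l m 1]
      polygonal_sum_replicate[of "drop l x" k m r]
    by simp
qed

text \<open>The listed values occur at \<open>x = 0, 1, -1, 2\<close>; the bound
  \<open>3 * m - 8\<close> is the value at \<open>x = -2\<close>.\<close>

lemma polygonal_cases:
  assumes "m \<ge> 4"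
  shows "polygonal m x \<in> {0, 1, m - 3, m} \<or> polygonal m x \<ge> 3 * m - 8"
proof -
  consider "x = 0" | "x = 1" | "x = -1" | "x = 2" | "x \<ge> 3" | "x \<le> -2" by linarith
  then show ?thesis
  proof cases
    case 5
    then have "2 * tri x \<ge> 3 * 2" unfolding two_times_tri by (intro mult_mono) auto
    then have "(m - 2) * tri x \<ge> (m - 2) * 3" using assms by (intro mult_left_mono) auto
    then show ?thesis using 5 by (simp add: polygonal_eq)
  next
    case 6
    \<comment> \<open>Splitting the value as \<open>(m - 3) * tri x + (tri x + x)\<close> absorbs
      the negative \<open>x\<close>: the bounds \<open>tri x \<ge> 3\<close> and
      \<open>tri x + x \<ge> 1\<close> suffice.\<close>
    have "(-x - 2) * (-x + 1) \<ge> 0" using 6 by (intro mult_nonneg_nonneg) auto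
    then have "tri x + x \<ge> 1" using two_times_tri[of x] by (simp add: algebra_simps)
    have "2 * tri x \<ge> 2 * 3" unfolding two_times_tri
      using mult_mono[of 2 "-x" 3 "1 - x"] 6 by (simp add: algebra_simps)
    then have "(m - 3) * tri x \<ge> (m - 3) * 3" using assms by (intro mult_left_mono) auto
    with \<open>tri x + x \<ge> 1\<close> show ?thesis by (simp add: polygonal_eq algebra_simps)
  qed (auto simp: polygonal_eq)
qed

lemma polygonal_nonneg: "m \<ge> 4 \<Longrightarrow> polygonal m x \<ge> 0"
  using polygonal_cases[of m x] by auto

lemma sum_polygonal_nonneg: "m \<ge> 4 \<Longrightarrow> (\<Sum>z\<leftarrow>x. polygonal m z) \<ge> 0"
  by (induction x) (auto simp: polygonal_nonneg)

lemma sum_polygonal_small: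
  assumes "m \<ge> 4" "(\<Sum>z\<leftarrow>x. polygonal m z) < m - 3"
  shows "(\<Sum>z\<leftarrow>x. polygonal m z) \<le> int (length x)"
  using assms(2)
proof (induction x)
  case (Cons y x)
  have "polygonal m y \<le> 1"
    using polygonal_cases[OF assms(1), of y] sum_polygonal_nonneg[OF assms(1), of x] Cons.prems assms(1)
    by auto
  then show ?case
    using Cons polygonal_nonneg[OF assms(1), of y] by auto
qed simp

section \<open>Upper and lower bounds for general coefficients\<close>

lemma ell_rep_eqI:
  assumes "universal m (replicate l1 1 @ replicate K r)"
    and "\<And>k. universal m (replicate l1 1 @ replicate k r) \<Longrightarrow> K \<le> k"
  shows "ell_rep m r l1 = l1 + K"
  unfolding ell_rep_def repeated_coeffs_def
proof (rule Least_equality)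
  fix l assume "l1 \<le> l \<and> universal m (replicate l1 1 @ replicate (l - l1) r)"
  then show "l1 + K \<le> l" using assms(2)[of "l - l1"] by linarith
qed (use assms(1) in simp)

text \<open>The integer \<open>m - 4\<close> is tested: every polygonal number involved is 0 or 1,
  so the sum of all coefficients must reach it.\<close>

lemma universal_lower_bound:
  assumes "m \<ge> 5" "r \<ge> 1" "universal m (replicate l 1 @ replicate k r)"
  shows "m - 4 \<le> int l + int r * int k"
proof -
  obtain x y where xy: "length x = l" "length y = k"
    "(\<Sum>z\<leftarrow>x. polygonal m z) + int r * (\<Sum>z\<leftarrow>y. polygonal m z) = m - 4"
    using universal_appendD[OF assms(3), of "m - 4"] assms(1) by auto
  let ?x = "\<Sum>z\<leftarrow>x. polygonal m z" and ?y = "\<Sum>z\<leftarrow>y. polygonal m z"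
  have nn: "?x \<ge> 0" "?y \<ge> 0" using assms(1) by (auto intro: sum_polygonal_nonneg)
  have "?y \<le> int r * ?y" using nn assms(2) by (simp add: mult_le_cancel_right1)
  moreover have "0 \<le> int r * ?y" using nn by simp
  ultimately have "?x \<le> int l" "?y \<le> int k"
    using sum_polygonal_small[of m x] sum_polygonal_small[of m y] xy nn assms(1) by auto
  moreover from this(2) have "int r * ?y \<le> int r * int k" by (intro mult_left_mono) auto
  ultimately show ?thesis using xy(3) by linarith
qed

text \<open>Remainders start at \<open>- d\<close> instead of 0. Negative ones come only with
  \<open>T \<ge> 1\<close>, where they are attainable, and the largest remainder drops by
  \<open>d\<close> in exchange.\<close>

lemma division_window:
  fixes n v d :: int
  assumes "v > 0" "n > 0" "d \<ge> 0"
  obtains T B where "n = v * T + B" "- d \<le> B" "B < v - d" "T = 0 \<and> B \<ge> 1 \<or> T \<ge> 1"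
proof (rule that[of "(n + d) div v" "(n + d) mod v - d"])
  have "v * ((n + d) div v) + (n + d) mod v = n + d" by simp
  then show n: "n = v * ((n + d) div v) + ((n + d) mod v - d)" by linarith
  show "- d \<le> (n + d) mod v - d" "(n + d) mod v - d < v - d"
    using pos_mod_sign[OF assms(1), of "n + d"] pos_mod_bound[OF assms(1), of "n + d"] by linarith+
  have "(n + d) div v \<ge> 0" using assms by (simp add: pos_imp_zdiv_nonneg_iff)
  then show "(n + d) div v = 0 \<and> (n + d) mod v - d \<ge> 1 \<or> (n + d) div v \<ge> 1"
    using n assms by (cases "(n + d) div v = 0") auto
qed

text \<open>The prefix \<open>a\<close> only has to meet the residues of \<open>T\<close> and
  \<open>B\<close> modulo \<open>r\<close>; the quotients go to the block, and the final disjunction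
  is that of \<open>rep_mult\<close> scaled by \<open>r\<close>.\<close>

lemma rep_combine:
  assumes "rep a T1 B1" "k \<ge> 5" "int r dvd T - T1" "int r dvd B - B1" "r > 0"
    and "T = T1 \<and> 0 \<le> B - B1 \<and> B - B1 \<le> int r * int k \<or>
      T > T1 \<and> - int r \<le> B - B1 \<and> B - B1 \<le> int r * int k + int r"
  shows "rep (a @ replicate k r) T B"
proof -
  obtain T' B' where T': "T - T1 = int r * T'" and B': "B - B1 = int r * B'"
    using assms(3,4) by (elim dvdE)
  have "T' = 0 \<and> 0 \<le> B' \<and> B' \<le> int k \<or> T' \<ge> 1 \<and> -1 \<le> B' \<and> B' \<le> int k + 1"
    using assms(6)
  proof (elim disjE conjE)
    assume *: "T = T1" "0 \<le> B - B1" "B - B1 \<le> int r * int k"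
    then have "T' = 0" using T' assms(5) by simp
    moreover have "0 \<le> B'" "B' \<le> int k" using *(2,3) assms(5) unfolding B' by (simp_all add: zero_le_mult_iff)
    ultimately show ?thesis by simp
  next
    assume *: "T > T1" "- int r \<le> B - B1" "B - B1 \<le> int r * int k + int r"
    have "int r * T' > 0" using *(1) T' by linarith
    then have "T' \<ge> 1" using assms(5) by (simp add: zero_less_mult_iff)
    moreover have "int r * (-1) \<le> int r * B'" "int r * B' \<le> int r * (int k + 1)"
      using *(2,3) unfolding B' by (simp_all add: algebra_simps)
    then have "-1 \<le> B'" "B' \<le> int k + 1" using assms(5) by (simp_all only: mult_le_cancel_left_pos of_nat_0_less_iff)
    ultimately show ?thesis by simp
  qed
  then have "rep (replicate k r) (T - T1) (B - B1)"
    unfolding T' B' using assms(2) by (rule rep_mult[rotated])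
  from rep_append[OF assms(1) this] show ?thesis by simp
qed

lemma ceiling_divide_bounds:
  fixes a :: int and r :: nat
  assumes "r > 0"
  shows "a \<le> int r * \<lceil>real_of_int a / real r\<rceil>" "int r * (\<lceil>real_of_int a / real r\<rceil> - 1) < a"
proof -
  let ?c = "\<lceil>real_of_int a / real r\<rceil>"
  have "real_of_int a \<le> of_int ?c * real r"
    using assms le_of_int_ceiling[of "real_of_int a / real r"] by (simp only: pos_divide_le_eq of_nat_0_less_iff)
  also have "\<dots> = real_of_int (int r * ?c)" by (simp only: of_int_mult of_int_of_nat_eq mult.commute)
  finally show "a \<le> int r * ?c" by (simp only: of_int_le_iff)
  have "of_int ?c - 1 < real_of_int a / real r" by linarith
  then have "(of_int ?c - 1) * real r < real_of_int a"
    using assms by (simp only: pos_less_divide_eq of_nat_0_less_iff)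
  then have "real_of_int (int r * (?c - 1)) < real_of_int a" by (simp add: mult.commute)
  then show "int r * (?c - 1) < a" by (simp only: of_int_less_iff)
qed

section \<open>All coefficients equal to 1\<close>

lemma universal_ones:
  assumes "m \<ge> 10"
  shows "universal m (replicate (nat (m - 4)) 1)"
proof (rule universalI)
  fix n :: int assume "n > 0"
  then obtain T B where n: "n = (m - 2) * T + B" and B: "-1 \<le> B" "B < m - 3"
    "T = 0 \<and> B \<ge> 1 \<or> T \<ge> 1"
    using division_window[of "m - 2" n 1] assms by auto
  have "rep (replicate (nat (m - 4)) 1) (int 1 * T) (int 1 * B)"
    using B assms by (intro rep_mult) auto
  then show "\<exists>T B. rep (replicate (nat (m - 4)) 1) T B \<and> n = (m - 2) * T + B"
    using n by auto
qed

lemma ell_eq: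
  assumes "m \<ge> 10"
  shows "int (ell m) = m - 4"
proof -
  have "ell m = nat (m - 4)"
    unfolding ell_def
  proof (rule Least_equality)
    fix l assume "1 \<le> l \<and> universal m (replicate l 1)"
    then show "nat (m - 4) \<le> l" using universal_lower_bound[of m 1 l 0] assms by simp
  qed (use assms universal_ones in simp)
  then show ?thesis using assms by simp
qed

section \<open>Coefficients of at least 6 and the ceiling formula\<close>

text \<open>At least five ones are present, so they alone realise every \<open>T \<ge> 1\<close>
  with remainders from -1 to \<open>r\<close>; the variables with coefficient \<open>r\<close> stay
  in 0 and 1 and supply a multiple \<open>r * s\<close>.\<close>

lemma universal_large_coefficient:
  assumes "r \<ge> 6" "m \<ge> 5" "m - 3 \<le> int r * (int k + 1)"
  shows "universal m (replicate (r - 1) 1 @ replicate k r)"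
proof (rule universalI)
  fix n :: int assume "n > 0"
  then obtain T B where n: "n = (m - 2) * T + B" and B: "-1 \<le> B" "B < m - 3"
    "T = 0 \<and> B \<ge> 1 \<or> T \<ge> 1"
    using division_window[of "m - 2" n 1] assms by auto
  \<comment> \<open>The shift makes the range start at 0 in both cases: the ones reach down to 0 for
    \<open>T = 0\<close>, and to -1 otherwise.\<close>
  define B' where "B' = (if T = 0 then B else B + 1)"
  define s where "s = min (B' div int r) (int k)"
  have B': "0 \<le> B'" "T = 0 \<Longrightarrow> B' \<le> m - 4" "B' \<le> m - 3" using B by (auto simp: B'_def)
  have s: "0 \<le> s" "s \<le> int k"
    using B' assms(1) by (auto simp: s_def pos_imp_zdiv_nonneg_iff)
  have "0 \<le> B' - int r * s \<and> B' - int r * s \<le> int r \<and> (T = 0 \<longrightarrow> B' - int r * s \<le> int r - 1)"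
  proof (cases "B' div int r \<le> int k")
    case True
    then have "B' - int r * s = B' mod int r" by (simp add: s_def minus_mult_div_eq_mod)
    moreover have "0 \<le> B' mod int r" "B' mod int r < int r" using assms(1) by simp_all
    ultimately show ?thesis by linarith
  next
    case False
    then have "s = int k" by (simp add: s_def)
    moreover have "int r * int k \<le> int r * (B' div int r)" using False by (intro mult_left_mono) auto
    moreover have "int r * (B' div int r) \<le> B'" using mult_div_mod_eq[of "int r" B'] pos_mod_sign[of "int r" B'] assms(1) by linarith
    ultimately show ?thesis using assms(3) B' by (auto simp: algebra_simps)
  qed
  then have "rep (replicate (r - 1) 1) (int 1 * T) (int 1 * (B - int r * s))"
    using assms(1) B(3) by (intro rep_mult) (auto simp: B'_def of_nat_diff)
  from rep_append[OF this rep_zero_one[OF s, of r]]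
  have "rep (replicate (r - 1) 1 @ replicate k r) T B" by simp
  then show "\<exists>T B. rep (replicate (r - 1) 1 @ replicate k r) T B \<and> n = (m - 2) * T + B"
    using n by auto
qed

text \<open>With \<open>r - 1\<close> ones, \<open>universal_lower_bound\<close> reads
  \<open>m - 3 \<le> r * (k + 1)\<close>, which is also the sufficient condition. The least such
  \<open>k\<close> is the ceiling minus 1, and \<open>r < m - 3\<close> makes it positive.\<close>

lemma ell_rep_eq_ceiling:
  assumes "r \<ge> 1" "m \<ge> 5" "int r < m - 3"
    and "\<And>k. m - 3 \<le> int r * (int k + 1) \<Longrightarrow> k \<ge> 1 \<Longrightarrow> universal m (replicate (r - 1) 1 @ replicate k r)"
  shows "int (ell_rep m r (r - 1)) = \<lceil>real_of_int (m - 3) / real r\<rceil> + (int r - 2)"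
proof -
  define c where "c = \<lceil>real_of_int (m - 3) / real r\<rceil>"
  have c: "m - 3 \<le> int r * c" "int r * (c - 1) < m - 3"
    using ceiling_divide_bounds[of r "m - 3"] assms(1) by (simp_all add: c_def)
  have "c > 1"
  proof (rule ccontr)
    assume "\<not> c > 1"
    then have "int r * c \<le> int r * 1" by (intro mult_left_mono) auto
    then show False using c assms(3) by simp
  qed
  have "ell_rep m r (r - 1) = (r - 1) + nat (c - 1)"
  proof (rule ell_rep_eqI)
    show "universal m (replicate (r - 1) 1 @ replicate (nat (c - 1)) r)"
      using c \<open>c > 1\<close> by (intro assms(4)) auto
  next
    fix k assume "universal m (replicate (r - 1) 1 @ replicate k r)"
    from universal_lower_bound[OF assms(2,1) this]
    have "m - 3 \<le> int r * (int k + 1)" using assms(1) by (simp add: of_nat_diff algebra_simps)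
    then have "int r * (c - 1) < int r * (int k + 1)" using c by linarith
    then have "c - 1 < int k + 1" using assms(1) by (simp add: mult_less_cancel_left_pos)
    then show "nat (c - 1) \<le> k" by linarith
  qed
  then show ?thesis using \<open>c > 1\<close> assms(1) by (simp add: c_def of_nat_diff)
qed

section \<open>The coefficient 5\<close>

text \<open>Even \<open>B\<close> are outside \<open>cauchy_lemma\<close>, so explicit points are
  given. The pair \<open>(3, 2)\<close> is absent: \<open>2 * T + B = 8\<close> is a sum of four
  squares only as \<open>4 + 4 + 0 + 0\<close>, whose roots never add up to 2.\<close>

lemma rep_four_table:
  assumes "(T, B) \<in> {(1, 0), (1, 2), (1, 4), (2, 0), (2, 2), (2, 4), (3, 0), (3, 4),
    (4, 0), (4, 2), (4, 4), (5, 0), (5, 2), (5, 4)}"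
  shows "rep (replicate 4 1) T B"
  using assms rep_four[of 1 "-1" 1 0 0] rep_four[of 1 2 0 0 0] rep_four[of 1 2 1 1 0]
    rep_four[of 1 "-1" "-1" 1 1] rep_four[of 1 "-1" 2 1 0] rep_four[of 1 2 2 0 0]
    rep_four[of 1 "-2" 1 1 0] rep_four[of 1 3 1 0 0]
    rep_four[of 1 "-2" 2 0 0] rep_four[of 1 3 "-1" 0 0] rep_four[of 1 3 "-1" 1 1]
    rep_four[of 1 "-2" "-1" 2 1] rep_four[of 1 "-2" 2 2 0] rep_four[of 1 3 2 "-1" 0]
  by auto

text \<open>Odd \<open>B\<close> come from \<open>cauchy_lemma\<close>. For even \<open>B\<close>,
  using one five more or less shifts the share of the ones by 5 and makes it odd; where
  \<open>T\<close> is too small for this, \<open>rep_four_table\<close> steps in.\<close>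

lemma rep_four_fives:
  assumes "k \<ge> 1" "T \<ge> 1" "-1 \<le> B" "B \<le> 5" "0 \<le> s" "s \<le> int k"
  shows "rep (replicate 4 1 @ replicate k 5) T (B + 5 * s)"
proof -
  have *: "rep (replicate 4 1 @ replicate k 5) T (B + 5 * s)"
    if "rep (replicate 4 1) (int 1 * T) (int 1 * (B - 5 * i))" "0 \<le> s + i" "s + i \<le> int k" for i
    using rep_append[OF that(1) rep_zero_one[OF that(2,3), of 5]] by (simp add: algebra_simps)
  have odd: "rep (replicate 4 1) (int 1 * T) (int 1 * (B - 5 * i))"
    if "odd (B - 5 * i)" "(B - 5 * i - 2)\<^sup>2 \<le> 8 * T + 4" for i
    using that by (rule rep_four_odd)
  have abs: "(x - 2)\<^sup>2 \<le> 8 * T + 4"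
    if x: "\<bar>x - 2\<bar> \<le> 3 \<or> \<bar>x - 2\<bar> \<le> 5 \<and> T \<ge> 3 \<or> \<bar>x - 2\<bar> \<le> 7 \<and> T \<ge> 6" for x
  proof -
    \<comment> \<open>The thresholds compare 9, 25, 49 with \<open>8 * T + 4\<close>, which is 12,
      28, 52 at \<open>T = 1, 3, 6\<close>.\<close>
    consider "\<bar>x - 2\<bar> \<le> \<bar>3\<bar>" | "\<bar>x - 2\<bar> \<le> \<bar>5\<bar>" "T \<ge> 3" | "\<bar>x - 2\<bar> \<le> \<bar>7\<bar>" "T \<ge> 6"
      using x by force
    then show ?thesis
      unfolding abs_le_square_iff using assms(2) by cases auto
  qed
  consider "odd B" | "even B" "T \<ge> 6 \<or> T = 3 \<and> B = 2" | "B \<in> {0, 2, 4}" "T \<in> {1, 2, 3, 4, 5}" "T \<noteq> 3 \<or> B \<noteq> 2"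
  proof -
    have "even B \<Longrightarrow> B \<in> {0, 2, 4}" using assms(3,4) by auto
    moreover have "T \<ge> 6 \<or> T \<in> {1, 2, 3, 4, 5}" using assms(2) by auto
    ultimately show ?thesis using that by blast
  qed
  then show ?thesis
  proof cases
    case 1
    have "rep (replicate 4 1) (int 1 * T) (int 1 * (B - 5 * 0))"
      using 1 assms by (intro odd abs) auto
    then show ?thesis using *[of 0] assms by auto
  next
    case 2
    have B: "\<bar>B - 5 - 2\<bar> \<le> 7" "\<bar>B + 5 - 2\<bar> \<le> 7 " using assms 2 by presburger+
    consider "s \<ge> 1" | "s + 1 \<le> int k" using assms by linarith
    then show ?thesis
    proof cases
      case 1
      have "rep (replicate 4 1) (int 1 * T) (int 1 * (B - 5 * (-1)))"
        using 2 B by (intro odd abs) auto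
      then show ?thesis using *[of "-1"] 1 assms by auto
    next
      case s: 2
      have "rep (replicate 4 1) (int 1 * T) (int 1 * (B - 5 * 1))"
        using 2 B by (intro odd abs) auto
      then show ?thesis using *[of 1] s assms by auto
    qed
  next
    case 3
    have "rep (replicate 4 1) T B"
      by (rule rep_four_table) (use 3 in auto)
    then show ?thesis using *[of 0] assms by auto
  qed
qed

lemma universal_fives:
  assumes "k \<ge> 1" "m \<ge> 10" "m - 3 \<le> 5 * (int k + 1)"
  shows "universal m (replicate 4 1 @ replicate k 5)"
proof (rule universalI)
  fix n :: int assume "n > 0"
  then obtain T B where n: "n = (m - 2) * T + B" and B: "-1 \<le> B" "B < m - 3"
    "T = 0 \<and> B \<ge> 1 \<or> T \<ge> 1"
    using division_window[of "m - 2" n 1] assms by auto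
  have "rep (replicate 4 1 @ replicate k 5) T B"
  proof (cases "T = 0")
    case True
    define s where "s = min (B div 5) (int k)"
    have "0 \<le> s" "s \<le> int k" "0 \<le> B - 5 * s" "B - 5 * s \<le> 4"
      using B True assms(3) by (auto simp: s_def min_def)
    then show ?thesis
      using rep_append[OF rep_zero_one[of "B - 5 * s" 4 1] rep_zero_one[of s k 5]] True by simp
  next
    case False
    define s where "s = min ((B + 1) div 5) (int k)"
    have "0 \<le> s" "s \<le> int k" "-1 \<le> B - 5 * s" "B - 5 * s \<le> 5"
      using B False assms(3) by (auto simp: s_def min_def)
    then show ?thesis
      using rep_four_fives[of k T "B - 5 * s" s] False B assms(1) by simp
  qed
  then show "\<exists>T B. rep (replicate 4 1 @ replicate k 5) T B \<and> n = (m - 2) * T + B"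
    using n by auto
qed

section \<open>The coefficients 2, 3 and 4\<close>

lemma rep_three:
  "rep (replicate 3 1) (tri x + tri y + tri z) (x + y + z)"
proof -
  have "rep [1, 1, 1] (int 1 * tri x + (int 1 * tri y + (int 1 * tri z + 0)))
      (int 1 * x + (int 1 * y + (int 1 * z + 0)))"
    by (intro rep.intros)
  then show ?thesis by (simp add: numeral_eq_Suc algebra_simps)
qed

lemma rep_two: "rep (replicate 2 1) (tri x + tri y) (x + y)"
proof -
  have "rep [1, 1] (int 1 * tri x + (int 1 * tri y + 0)) (int 1 * x + (int 1 * y + 0))"
    by (intro rep.intros)
  then show ?thesis by (simp add: numeral_eq_Suc algebra_simps)
qed

lemma rep_three_table:
  assumes "(T, B) \<in> {(0, 0), (0, 1), (0, 2), (0, 3), (1, -1), (1, 0), (1, 1), (1, 2), (1, 3), (1, 4),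
    (2, -2), (2, -1), (2, 1), (2, 2), (2, 4), (2, 5),
    (3, -3), (3, -2), (3, -1), (3, 0), (3, 3), (3, 5), (3, 6)}"
  shows "rep (replicate 3 1) T B"
  using assms rep_three[of 0 0 0] rep_three[of 0 0 1] rep_three[of 0 1 1] rep_three[of 1 1 1]
    rep_three[of "-1" 0 0] rep_three[of "-1" 0 1] rep_three[of "-1" 1 1]
    rep_three[of 2 0 0] rep_three[of 2 0 1] rep_three[of 2 1 1]
    rep_three[of "-1" "-1" 0] rep_three[of "-1" "-1" 1] rep_three[of "-1" 2 0] rep_three[of "-1" 2 1]
    rep_three[of 2 2 0] rep_three[of 2 2 1]
    rep_three[of "-1" "-1" "-1"] rep_three[of "-2" 0 0] rep_three[of "-2" 0 1] rep_three[of "-2" 1 1]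
    rep_three[of 3 0 0] rep_three[of 3 1 1] rep_three[of 2 2 2]
  by auto

text \<open>The ones meet the residues modulo 4. For \<open>T = 2\<close> the fours add nothing to
  \<open>T\<close> and the ones sum to -2, -1, 1, 2, 4 or 5, so \<open>B = 0\<close> is out of
  reach; the wider range at \<open>T = 1\<close> serves to replace that pair.\<close>

lemma rep_three_fours:
  assumes "k \<ge> 5" "T \<ge> 0" "-1 \<le> B" "T = 0 \<Longrightarrow> B \<ge> 0"
    "B \<le> 4 * int k + 2 \<or> T = 1 \<and> B \<le> 4 * int k + 4" "T \<noteq> 2 \<or> B \<noteq> 0"
  shows "rep (replicate 3 1 @ replicate k 4) T B"
proof -
  have *: "rep (replicate 3 1 @ replicate k 4) T B"
    if "rep (replicate 3 1) T1 B1" "4 dvd T - T1" "4 dvd B - B1"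
      "T = T1 \<and> 0 \<le> B - B1 \<and> B - B1 \<le> 4 * int k \<or>
       T > T1 \<and> - 4 \<le> B - B1 \<and> B - B1 \<le> 4 * int k + 4" for T1 B1
    using rep_combine[OF that(1) assms(1), of 4 T B] that(2-) by simp
  note table = rep_three_table
  \<comment> \<open>The values 1, 2, 3 are separate: there the fours are confined to 0 and 1, and
    \<open>B - B1\<close> loses the slack of 4 on either side.\<close>
  have "T mod 4 = 0 \<or> T = 1 \<or> T = 2 \<or> T = 3 \<or> T mod 4 = 1 \<and> T > 1 \<or>
      T mod 4 = 2 \<and> T > 2 \<or> T mod 4 = 3 \<and> T > 3"
    using assms(2) by presburger
  then consider "T mod 4 = 0" | "T = 1" | "T = 2" | "T = 3" | "T mod 4 = 1" "T > 1"
    | "T mod 4 = 2" "T > 2" | "T mod 4 = 3" "T > 3"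
    by blast
  then show ?thesis
  proof cases
    case 1
    then have "4 dvd T - 0" "4 dvd B - B mod 4" "B mod 4 \<in> {0, 1, 2, 3}" by auto
    moreover have "T = 0 \<and> 0 \<le> B - B mod 4 \<and> B - B mod 4 \<le> 4 * int k \<or>
       T > 0 \<and> - 4 \<le> B - B mod 4 \<and> B - B mod 4 \<le> 4 * int k + 4"
      using assms by presburger
    ultimately show ?thesis using *[OF table, of 0 "B mod 4"] by auto
  next
    case 2
    \<comment> \<open>Above \<open>4 * k + 2\<close> all fours are used and the ones supply 3 or
      4.\<close>
    define B1 where "B1 = (if B > 4 * int k + 2 then B - 4 * int k else (B + 1) mod 4 - 1)"
    have "B1 \<in> {-1, 0, 1, 2, 3, 4}" using assms(5) 2 by (auto simp: B1_def)
    then have "rep (replicate 3 1) 1 B1" by (intro table) auto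
    moreover have "4 dvd B - B1" unfolding B1_def by presburger
    moreover have "0 \<le> B - B1" "B - B1 \<le> 4 * int k" using assms(3) 2 unfolding B1_def by presburger+
    ultimately show ?thesis using *[of 1 B1] 2 by simp
  next
    case 3
    have "B mod 4 = 0 \<Longrightarrow> B \<ge> 4" using assms(3,6) 3 by presburger
    then consider "B mod 4 = 0" "B \<ge> 4" | "B mod 4 = 1" | "B mod 4 = 2" | "B mod 4 = 3"
      by linarith
    then show ?thesis
    proof cases
      case 1
      show ?thesis
        by (rule *[OF table, of 2 4]) (use 1 3 assms in \<open>(simp; fail) | presburger\<close>)+
    next
      case 2
      show ?thesis
        by (rule *[OF table, of 2 1]) (use 2 3 assms in \<open>(simp; fail) | presburger\<close>)+
    next
      case c3: 3
      show ?thesis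
        by (rule *[OF table, of 2 2]) (use c3 3 assms in \<open>(simp; fail) | presburger\<close>)+
    next
      case 4
      show ?thesis
        by (rule *[OF table, of 2 "-1"]) (use 4 3 assms in \<open>(simp; fail) | presburger\<close>)+
    qed
  next
    case 4
    \<comment> \<open>At \<open>T = 3\<close> each nonzero residue has two choices of
      \<open>B1\<close>: -3, -2, -1 for the least \<open>B\<close>, and 5, 6, 3 for larger ones,
      keeping \<open>B - B1\<close> at most \<open>4 * k\<close>.\<close>
    have "B mod 4 = 0 \<or> B = 1 \<or> B = 2 \<or> B = -1 \<or> B mod 4 = 1 \<and> B > 1 \<or>
        B mod 4 = 2 \<and> B > 2 \<or> B mod 4 = 3 \<and> B > -1"
      using assms(3) by presburger
    then consider "B mod 4 = 0" | "B = 1" | "B = 2" | "B = -1" | "B mod 4 = 1" "B > 1"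
      | "B mod 4 = 2" "B > 2" | "B mod 4 = 3" "B > -1"
      by blast
    then show ?thesis
    proof cases
      case 1
      show ?thesis
        by (rule *[OF table, of 3 0]) (use 1 4 assms in \<open>(simp; fail) | presburger\<close>)+
    next
      case 2
      show ?thesis
        by (rule *[OF table, of 3 "-3"]) (use 2 4 assms in \<open>(simp; fail) | presburger\<close>)+
    next
      case 3
      show ?thesis
        by (rule *[OF table, of 3 "-2"]) (use 3 4 assms in \<open>(simp; fail) | presburger\<close>)+
    next
      case c4: 4
      show ?thesis
        by (rule *[OF table, of 3 "-1"]) (use c4 4 assms in \<open>(simp; fail) | presburger\<close>)+
    next
      case 5
      show ?thesis
        by (rule *[OF table, of 3 5]) (use 5 4 assms in \<open>(simp; fail) | presburger\<close>)+
    next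
      case 6
      show ?thesis
        by (rule *[OF table, of 3 6]) (use 6 4 assms in \<open>(simp; fail) | presburger\<close>)+
    next
      case 7
      show ?thesis
        by (rule *[OF table, of 3 3]) (use 7 4 assms in \<open>(simp; fail) | presburger\<close>)+
    qed
  next
    case 5
    define B1 where "B1 = (B + 1) mod 4 - 1"
    have "B1 \<in> {-1, 0, 1, 2}" by (auto simp: B1_def)
    then have "rep (replicate 3 1) 1 B1" by (intro table) auto
    moreover have "4 dvd B - B1" unfolding B1_def by presburger
    moreover have "- 4 \<le> B - B1" "B - B1 \<le> 4 * int k" using assms(3,5) 5 unfolding B1_def by presburger+
    moreover have "4 dvd T - 1" using 5 by presburger
    ultimately show ?thesis using *[of 1 B1] 5 by simp
  next
    case 6
    then have T: "4 dvd T - 2" by presburger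
    consider "B mod 4 = 0" | "B mod 4 = 1" | "B mod 4 = 2" | "B mod 4 = 3" by linarith
    then show ?thesis
    proof cases
      case 1
      show ?thesis
        by (rule *[OF table, of 2 4]) (use 1 6 T assms in \<open>(simp; fail) | presburger\<close>)+
    next
      case 2
      show ?thesis
        by (rule *[OF table, of 2 1]) (use 2 6 T assms in \<open>(simp; fail) | presburger\<close>)+
    next
      case 3
      show ?thesis
        by (rule *[OF table, of 2 2]) (use 3 6 T assms in \<open>(simp; fail) | presburger\<close>)+
    next
      case 4
      show ?thesis
        by (rule *[OF table, of 2 "-1"]) (use 4 6 T assms in \<open>(simp; fail) | presburger\<close>)+
    qed
  next
    case 7
    then have T: "4 dvd T - 3" by presburger
    consider "B mod 4 = 0" | "B mod 4 = 1" | "B mod 4 = 2" | "B mod 4 = 3" by linarith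
    then show ?thesis
    proof cases
      case 1
      show ?thesis
        by (rule *[OF table, of 3 0]) (use 1 7 T assms in \<open>(simp; fail) | presburger\<close>)+
    next
      case 2
      show ?thesis
        by (rule *[OF table, of 3 "-3"]) (use 2 7 T assms in \<open>(simp; fail) | presburger\<close>)+
    next
      case 3
      show ?thesis
        by (rule *[OF table, of 3 "-2"]) (use 3 7 T assms in \<open>(simp; fail) | presburger\<close>)+
    next
      case 4
      show ?thesis
        by (rule *[OF table, of 3 3]) (use 4 7 T assms in \<open>(simp; fail) | presburger\<close>)+
    qed
  qed
qed

text \<open>Only \<open>n = 2 * (m - 2)\<close> meets the exception of
  \<open>rep_three_fours\<close>; it is rewritten with \<open>T = 1\<close> and
  \<open>B = m - 2\<close>.\<close>

lemma universal_fours: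
  assumes "k \<ge> 5" "m \<ge> 5" "m - 6 \<le> 4 * int k"
  shows "universal m (replicate 3 1 @ replicate k 4)"
proof (rule universalI)
  fix n :: int assume "n > 0"
  then obtain T B where n: "n = (m - 2) * T + B" and B: "-1 \<le> B" "B < m - 3"
    "T = 0 \<and> B \<ge> 1 \<or> T \<ge> 1"
    using division_window[of "m - 2" n 1] assms by auto
  show "\<exists>T B. rep (replicate 3 1 @ replicate k 4) T B \<and> n = (m - 2) * T + B"
  proof (cases "T = 2 \<and> B = 0")
    case True
    then have "n = (m - 2) * 1 + (m - 2)" using n by simp
    moreover have "rep (replicate 3 1 @ replicate k 4) 1 (m - 2)"
      using assms by (intro rep_three_fours) auto
    ultimately show ?thesis by blast
  next
    case False
    then have "rep (replicate 3 1 @ replicate k 4) T B"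
      using assms B by (intro rep_three_fours) auto
    then show ?thesis using n by blast
  qed
qed

lemma polygonal_list_small:
  assumes "m \<ge> 4" "int r * (\<Sum>z\<leftarrow>y. polygonal m z) < int r * (m - 3)"
  shows "0 \<le> (\<Sum>z\<leftarrow>y. polygonal m z)" "(\<Sum>z\<leftarrow>y. polygonal m z) \<le> int (length y)"
  using sum_polygonal_nonneg[of m y] sum_polygonal_small[of m y] assms
  by (simp_all add: mult_less_cancel_left)

text \<open>The general bound leaves only \<open>4 * k = m - 7\<close>, so \<open>m\<close> is 3
  modulo 4. For \<open>2 * (m - 2)\<close> the ones would need a total between \<open>m + 3\<close>
  and \<open>2 * m - 4\<close> that is 2 modulo 4; three values among 0, 1, \<open>m - 3\<close>,
  \<open>m\<close> give none.\<close>

lemma lower_bound_fours: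
  assumes "m \<ge> 10" "universal m (replicate 3 1 @ replicate k 4)"
  shows "m - 6 \<le> 4 * int k"
proof (rule ccontr)
  assume *: "\<not> m - 6 \<le> 4 * int k"
  moreover have "m - 4 \<le> 3 + 4 * int k" using universal_lower_bound[OF _ _ assms(2)] assms(1) by simp
  ultimately have k: "4 * int k = m - 7" by linarith
  obtain x y where xy: "length x = 3" "length y = k"
    "(\<Sum>z\<leftarrow>x. polygonal m z) + int 4 * (\<Sum>z\<leftarrow>y. polygonal m z) = 2 * m - 4"
    using universal_appendD[OF assms(2), of "2 * m - 4"] assms(1) by auto
  obtain p q s where x: "x = [p, q, s]" using xy(1) by (auto simp: numeral_eq_Suc length_Suc_conv)
  define S where "S = (\<Sum>z\<leftarrow>y. polygonal m z)"
  have sum: "polygonal m p + polygonal m q + polygonal m s + 4 * S = 2 * m - 4"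
    using xy(3) by (simp add: x S_def)
  have nn: "polygonal m z \<ge> 0" for z using polygonal_nonneg assms(1) by simp
  have "S \<ge> 0" "S \<le> int k"
    using polygonal_list_small[of m 4 y] sum nn[of p] nn[of q] nn[of s] assms(1) xy(2) by (auto simp: S_def)
  moreover have "polygonal m z \<in> {0, 1, m - 3, m}" if "z \<in> {p, q, s}" for z
    using polygonal_cases[of m z] that sum nn[of p] nn[of q] nn[of s] \<open>S \<ge> 0\<close> assms(1) by auto
  then have "polygonal m p \<in> {0, 1, m - 3, m}" "polygonal m q \<in> {0, 1, m - 3, m}" "polygonal m s \<in> {0, 1, m - 3, m}"
    by blast+
  ultimately show False using sum k assms(1) by auto presburger+
qed

lemma ell_rep_4:
  assumes "m \<ge> 62"
  shows "int (ell_rep m 4 3) = \<lceil>real_of_int (m - 2) / 4\<rceil> + 2"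
proof -
  define c where "c = \<lceil>real_of_int (m - 2) / 4\<rceil>"
  have c: "m - 2 \<le> 4 * c" "4 * (c - 1) < m - 2"
    using ceiling_divide_bounds[of 4 "m - 2"] by (simp_all add: c_def)
  have "ell_rep m 4 3 = 3 + nat (c - 1)"
  proof (rule ell_rep_eqI)
    show "universal m (replicate 3 1 @ replicate (nat (c - 1)) 4)"
      using c assms by (intro universal_fours) auto
  next
    fix k assume "universal m (replicate 3 1 @ replicate k 4)"
    then show "nat (c - 1) \<le> k" using lower_bound_fours[of m k] c assms by simp
  qed
  then show ?thesis using c assms by (simp add: c_def)
qed

section \<open>The coefficient 3\<close>

lemma rep_two_table:
  assumes "(T, B) \<in> {(0, 0), (0, 1), (0, 2), (1, -1), (1, 0), (1, 2), (1, 3), (2, -2), (2, 1), (2, 4)}"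
  shows "rep (replicate 2 1) T B"
  using assms rep_two[of 0 0] rep_two[of 0 1] rep_two[of 1 1] rep_two[of "-1" 0] rep_two[of "-1" 1]
    rep_two[of 2 0] rep_two[of 2 1] rep_two[of "-1" "-1"] rep_two[of "-1" 2] rep_two[of 2 2]
  by auto

text \<open>As the first component is a multiple of 3, the two ones may stay in 0 and 1, where their
  sum meets every residue modulo 3.\<close>

lemma rep_two_threes:
  assumes "k \<ge> 5" "j \<ge> 0" "0 \<le> B \<and> B \<le> 3 * int k + 2 \<or> j \<ge> 1 \<and> -3 \<le> B \<and> B \<le> 3 * int k + 5"
  shows "rep (replicate 2 1 @ replicate k 3) (3 * j) B"
proof -
  have B: "3 dvd B - B mod 3" "B mod 3 \<in> {0, 1, 2}" by auto
  have "rep (replicate 2 1) 0 (B mod 3)" using B by (intro rep_two_table) auto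
  then show ?thesis
    by (rule rep_combine[OF _ assms(1)]) (use assms B in \<open>auto, presburger+\<close>)
qed

text \<open>Dividing by \<open>3 * (m - 2)\<close> keeps \<open>T\<close> a multiple of 3, at the
  price of remainders up to \<open>3 * m - 10\<close>.\<close>

lemma universal_threes_long:
  assumes "k \<ge> 5" "m \<ge> 5" "m - 4 \<le> int k"
  shows "universal m (replicate 2 1 @ replicate k 3)"
proof (rule universalI)
  fix n :: int assume "n > 0"
  then obtain j B where n: "n = 3 * (m - 2) * j + B" and B: "- 3 \<le> B" "B < 3 * (m - 2) - 3"
    "j = 0 \<and> B \<ge> 1 \<or> j \<ge> 1"
    using division_window[of "3 * (m - 2)" n 3] assms by auto
  have n: "n = (m - 2) * (3 * j) + B" using n by simp
  have "rep (replicate 2 1 @ replicate k 3) (3 * j) B"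
    using assms B by (intro rep_two_threes) auto
  then show "\<exists>T B. rep (replicate 2 1 @ replicate k 3) T B \<and> n = (m - 2) * T + B"
    using n by blast
qed

text \<open>Now 3 divides \<open>v = m - 2\<close>, so moving \<open>v\<close> or
  \<open>2 * v\<close> from \<open>B\<close> to \<open>T\<close> preserves \<open>B\<close> modulo 3
  and spares large remainders. Residue 1 needs \<open>2 * v\<close>, since two ones with
  \<open>T = 1\<close> never sum to 1 modulo 3.\<close>

lemma universal_threes_short:
  assumes "u \<ge> 4" "m = 3 * u + 2" "int k = 2 * u - 2"
  shows "universal m (replicate 2 1 @ replicate k 3)"
proof (rule universalI)
  fix n :: int assume "n > 0"
  let ?a = "replicate 2 1 @ replicate k 3"
  define v where "v = m - 2"
  have v: "v = 3 * u" "3 * int k = 2 * v - 6" "v \<ge> 12" "k \<ge> 5" using assms by (simp_all add: v_def)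
  obtain j B where n: "n = 3 * v * j + B" and B: "- 3 \<le> B" "B < 3 * v - 3"
    "j = 0 \<and> B \<ge> 1 \<or> j \<ge> 1"
    using division_window[of "3 * v" n 3] \<open>n > 0\<close> v(3) by auto
  have n: "n = v * (3 * j) + B" using n by simp
  have *: "rep ?a (3 * j + T1) B'"
    if "rep (replicate 2 1) T1 B1" "3 dvd B' - B1" "0 \<le> B' - B1" "B' - B1 \<le> 3 * int k" for T1 B1 B'
    by (rule rep_combine[OF that(1) v(4)]) (use that B in auto)
  have "\<exists>T B. rep ?a T B \<and> n = v * T + B"
  proof (cases "B \<le> 2 * v - 4")
    case True
    then have "rep ?a (3 * j) B" using True v B by (intro rep_two_threes) auto
    then show ?thesis using n by blast
  next
    case False
    have mod: "(B - v) mod 3 = B mod 3" "(B - 2 * v) mod 3 = B mod 3" unfolding v(1) by presburger+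
    consider "B mod 3 = 0" | "B mod 3 = 1" | "B mod 3 = 2" by linarith
    then show ?thesis
    proof cases
      case 1
      then have "rep ?a (3 * j + 1) (B - v)"
        using False B v mod by (intro *[OF rep_two_table, of 1 0]) (auto, presburger+)
      moreover have "n = v * (3 * j + 1) + (B - v)" using n by (simp add: algebra_simps)
      ultimately show ?thesis by blast
    next
      case 2
      \<comment> \<open>With -3 excluded, \<open>B - 2 * v\<close> is at least -2, the amount taken
        by the ones.\<close>
      have "B - 2 * v \<noteq> -3" using 2 v(1) by presburger
      then have "rep ?a (3 * j + 2) (B - 2 * v)"
        using False 2 B v mod by (intro *[OF rep_two_table, of 2 "-2"]) (auto, presburger+)
      moreover have "n = v * (3 * j + 2) + (B - 2 * v)" using n by (simp add: algebra_simps)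
      ultimately show ?thesis by blast
    next
      case 3
      then have "rep ?a (3 * j + 1) (B - v)"
        using False B v mod by (intro *[OF rep_two_table, of 1 2]) (auto, presburger+)
      moreover have "n = v * (3 * j + 1) + (B - v)" using n by (simp add: algebra_simps)
      ultimately show ?thesis by blast
    qed
  qed
  then show "\<exists>T B. rep ?a T B \<and> n = (m - 2) * T + B" by (simp add: v_def)
qed

text \<open>Below \<open>3 * (m - 3)\<close> the ones cannot reach \<open>3 * m - 8\<close>, and the
  variables with coefficient 3 have values 0 or 1.\<close>

lemma universal_threesD:
  assumes "m \<ge> 10" "universal m (replicate 2 1 @ replicate k 3)" "n > 0" "n < 3 * (m - 3)"
  obtains P Q S where "P + Q + 3 * S = n" "S \<le> int k" "S \<ge> 0"
    "P \<in> {0, 1, m - 3, m}" "Q \<in> {0, 1, m - 3, m}"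
proof -
  obtain x y where xy: "length x = 2" "length y = k"
    "(\<Sum>z\<leftarrow>x. polygonal m z) + int 3 * (\<Sum>z\<leftarrow>y. polygonal m z) = n"
    using universal_appendD[OF assms(2,3)] by auto
  obtain p q where x: "x = [p, q]" using xy(1) by (auto simp: numeral_eq_Suc length_Suc_conv)
  define S where "S = (\<Sum>z\<leftarrow>y. polygonal m z)"
  have sum: "polygonal m p + polygonal m q + 3 * S = n"
    using xy(3) by (simp add: x S_def)
  have nn: "polygonal m z \<ge> 0" for z using polygonal_nonneg assms(1) by simp
  have S: "S \<ge> 0" "S \<le> int k"
    using polygonal_list_small[of m 3 y] sum nn[of p] nn[of q] assms xy(2) by (auto simp: S_def)
  have "polygonal m z \<in> {0, 1, m - 3, m}" if "z \<in> {p, q}" for z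
    using polygonal_cases[of m z] that sum nn[of p] nn[of q] S assms by auto
  then show ?thesis using that[OF sum S(2,1)] by blast
qed

lemma ell_rep_3_long:
  assumes "m \<ge> 10" "m mod 3 \<noteq> 2"
  shows "int (ell_rep m 3 2) = m - 2"
proof -
  have "ell_rep m 3 2 = 2 + nat (m - 4)"
  proof (rule ell_rep_eqI)
    show "universal m (replicate 2 1 @ replicate (nat (m - 4)) 3)"
      using assms by (intro universal_threes_long) auto
  next
    fix k assume u: "universal m (replicate 2 1 @ replicate k 3)"
    consider "m mod 3 = 0" | "m mod 3 = 1" using assms(2) by linarith
    then have "m - 4 \<le> int k"
    proof cases
      case 1
      \<comment> \<open>This integer is 2 modulo 3 and the four values are 0, 1, 0, 0, so
        \<open>P = Q = 1\<close> and \<open>S = m - 4\<close>.\<close>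
      obtain P Q S where "P + Q + 3 * S = 3 * (m - 2) - 4" "S \<le> int k" "S \<ge> 0"
        "P \<in> {0, 1, m - 3, m}" "Q \<in> {0, 1, m - 3, m}"
        using universal_threesD[OF assms(1) u, of "3 * (m - 2) - 4"] assms(1) by auto
      then show ?thesis using 1 by auto presburger+
    next
      case 2
      \<comment> \<open>This integer is 0 modulo 3 and the four values are 0, 1, 1, 1, so
        \<open>P = Q = 0\<close> and \<open>S = m - 4\<close>.\<close>
      obtain P Q S where "P + Q + 3 * S = 3 * (m - 2) - 6" "S \<le> int k" "S \<ge> 0"
        "P \<in> {0, 1, m - 3, m}" "Q \<in> {0, 1, m - 3, m}"
        using universal_threesD[OF assms(1) u, of "3 * (m - 2) - 6"] assms(1) by auto
      then show ?thesis using 2 by auto presburger+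
    qed
    then show "nat (m - 4) \<le> k" by simp
  qed
  then show ?thesis using assms(1) by simp
qed

lemma ell_rep_3_short:
  assumes "m \<ge> 14" "m mod 3 = 2"
  shows "real (ell_rep m 3 2) = real_of_int (2 * m - 4) / 3"
proof -
  define u where "u = m div 3"
  have m: "m = 3 * u + 2" "u \<ge> 4" using assms unfolding u_def by presburger+
  have "ell_rep m 3 2 = 2 + nat (2 * u - 2)"
  proof (rule ell_rep_eqI)
    show "universal m (replicate 2 1 @ replicate (nat (2 * u - 2)) 3)"
      using m by (intro universal_threes_short) auto
  next
    fix k assume univ: "universal m (replicate 2 1 @ replicate k 3)"
    \<comment> \<open>This integer is 1 modulo 3 and the four values are 0, 1, 2, 2; two of residue
      2 are too large, so \<open>P + Q = 1\<close>.\<close>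
    obtain P Q S where "P + Q + 3 * S = 2 * (m - 2) - 5" "S \<le> int k" "S \<ge> 0"
      "P \<in> {0, 1, m - 3, m}" "Q \<in> {0, 1, m - 3, m}"
      using universal_threesD[OF _ univ, of "2 * (m - 2) - 5"] assms(1) by auto
    then have "2 * u - 2 \<le> int k" using m by auto presburger+
    then show "nat (2 * u - 2) \<le> k" by simp
  qed
  then have "int (ell_rep m 3 2) = 2 * u" using m by simp
  then have "real (ell_rep m 3 2) = real_of_int (2 * u)" by (metis of_int_of_nat_eq)
  then show ?thesis by (simp add: m)
qed

section \<open>The coefficient 2\<close>

lemma rep_one: "rep (replicate 1 1) (tri x) x"
  using rep.Cons[OF rep.Nil, of 1 x] by simp

text \<open>The single one settles parities, with \<open>x\<close> in 0, 1 for even \<open>T\<close>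
  and in -1, 2 for odd \<open>T\<close>. Only \<open>(1, 0)\<close> fails, as \<open>x = 2\<close>
  would leave -2 to twos confined to 0 and 1; it becomes \<open>(0, m - 2)\<close>.\<close>

lemma universal_twos:
  assumes "m \<ge> 14" "int k = m div 2 - 1"
  shows "universal m (replicate 1 1 @ replicate k 2)"
proof (rule universalI)
  fix n :: int assume "n > 0"
  let ?a = "replicate 1 1 @ replicate k 2"
  obtain T B where n: "n = (m - 2) * T + B" and B: "-1 \<le> B" "B < m - 3"
    "T = 0 \<and> B \<ge> 1 \<or> T \<ge> 1"
    using division_window[of "m - 2" n 1] assms \<open>n > 0\<close> by auto
  have k: "k \<ge> 5" "m - 3 \<le> 2 * int k" "2 * int k \<le> m - 2" using assms by presburger+
  have *: "rep ?a T B"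
    if "2 dvd T - tri x" "2 dvd B - x"
      "T = tri x \<and> 0 \<le> B - x \<and> B - x \<le> 2 * int k \<or> T > tri x \<and> - 2 \<le> B - x \<and> B - x \<le> 2 * int k + 2" for T B x
    using rep_combine[OF rep_one k(1), of 2 T x B] that by simp
  show "\<exists>T B. rep ?a T B \<and> n = (m - 2) * T + B"
  proof (cases "T = 1 \<and> B = 0")
    case True
    have "rep ?a 0 (m - 2)"
    proof (cases "even m")
      case True
      then show ?thesis using k assms by (intro *[of _ 0]) auto
    next
      case False
      then show ?thesis using k assms by (intro *[of _ 1]) auto
    qed
    moreover have "n = (m - 2) * 0 + (m - 2)" using n True by simp
    ultimately show ?thesis by blast
  next
    case False
    have "rep ?a T B"
    proof (cases "even T")
      case T: True
      show ?thesis
      proof (cases "even B")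
        case True
        then show ?thesis using T k B by (intro *[of _ 0]) auto
      next
        case False
        then show ?thesis using T k B by (intro *[of _ 1]) auto
      qed
    next
      case T: False
      show ?thesis
      proof (cases "even B")
        case True
        then have "B \<ge> 0" "T = 1 \<longrightarrow> B \<ge> 2" using B False by presburger+
        then show ?thesis using T True k B by (intro *[of _ 2]) auto
      next
        case False
        then show ?thesis using T k B by (intro *[of _ "-1"]) auto
      qed
    qed
    then show ?thesis using n by blast
  qed
qed

lemma ell_rep_2:
  assumes "m \<ge> 14"
  shows "int (ell_rep m 2 1) = \<lfloor>real_of_int m / 2\<rfloor>"
proof -
  have "ell_rep m 2 1 = 1 + nat (m div 2 - 1)"
  proof (rule ell_rep_eqI)
    show "universal m (replicate 1 1 @ replicate (nat (m div 2 - 1)) 2)"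
      using assms by (intro universal_twos) auto
  next
    fix k assume univ: "universal m (replicate 1 1 @ replicate k 2)"
    \<comment> \<open>For \<open>m - 2\<close>, the value \<open>m - 3\<close> of the single one
      would leave 1, which is odd; so it is 0 or 1 and the twos supply the rest.\<close>
    obtain x y where xy: "length x = 1" "length y = k"
      "(\<Sum>z\<leftarrow>x. polygonal m z) + int 2 * (\<Sum>z\<leftarrow>y. polygonal m z) = m - 2"
      using universal_appendD[OF univ, of "m - 2"] assms by auto
    obtain p where x: "x = [p]" using xy(1) by (auto simp: length_Suc_conv)
    define S where "S = (\<Sum>z\<leftarrow>y. polygonal m z)"
    have sum: "polygonal m p + 2 * S = m - 2" using xy(3) by (simp add: x S_def)
    have "polygonal m p \<ge> 0" using polygonal_nonneg assms by simp
    then have S: "0 \<le> S" "S \<le> int k"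
      using polygonal_list_small[of m 2 y] sum assms xy(2) by (auto simp: S_def)
    then have "polygonal m p \<in> {0, 1, m - 3}" using polygonal_cases[of m p] sum assms by auto
    then have "m div 2 - 1 \<le> int k" using sum S assms by auto presburger+
    then show "nat (m div 2 - 1) \<le> k" by simp
  qed
  then have "int (ell_rep m 2 1) = m div 2" using assms by simp
  also have "\<dots> = \<lfloor>real_of_int m / 2\<rfloor>" using floor_divide_of_int_eq[where 'a = real, of m 2] by simp
  finally show ?thesis .
qed

section \<open>Small values of m\<close>

lemma universal_replicate_one_iff:
  "universal m (replicate k 1) \<longleftrightarrow>
    (\<forall>n>0. \<exists>x. length x = k \<and> (\<Sum>z\<leftarrow>x. polygonal m z) = n)"
proof -
  have "polygonal_sum m (replicate k 1) x = (\<Sum>z\<leftarrow>x. polygonal m z)" if "length x = k" for x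
    using polygonal_sum_replicate[OF that, of m 1] by simp
  then have "universal m (replicate k 1) \<longleftrightarrow>
      (\<forall>n::nat. n > 0 \<longrightarrow> (\<exists>x. length x = k \<and> (\<Sum>z\<leftarrow>x. polygonal m z) = int n))"
    unfolding universal_def length_replicate by metis
  also have "\<dots> \<longleftrightarrow> (\<forall>n>0. \<exists>x. length x = k \<and> (\<Sum>z\<leftarrow>x. polygonal m z) = n)"
    by (metis int_nat_eq of_nat_0_less_iff zless_nat_eq_int_zless order_less_imp_le)
  finally show ?thesis .
qed

text \<open>Padding with zeros preserves universality, so refuting length \<open>k\<close> refutes
  all shorter ones.\<close>

lemma ell_eqI:
  assumes "universal m (replicate (Suc k) 1)" "\<not> universal m (replicate k 1)"
  shows "ell m = Suc k"
  unfolding ell_def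
proof (rule Least_equality)
  fix l assume "1 \<le> l \<and> universal m (replicate l 1)"
  then have l: "universal m (replicate l 1)" by simp
  show "Suc k \<le> l"
  proof (rule ccontr)
    assume "\<not> Suc k \<le> l"
    have "\<exists>x. length x = k \<and> (\<Sum>z\<leftarrow>x. polygonal m z) = n" if "n > 0" for n
    proof -
      obtain x where "length x = l" "(\<Sum>z\<leftarrow>x. polygonal m z) = n"
        using l \<open>n > 0\<close> unfolding universal_replicate_one_iff by blast
      then show ?thesis
        using \<open>\<not> Suc k \<le> l\<close>
        by (intro exI[of _ "x @ replicate (k - l) 0"])
           (simp add: polygonal_def map_replicate_const sum_list_replicate)
    qed
    then show False using assms(2) unfolding universal_replicate_one_iff by blast
  qed
qed (use assms(1) in simp)

lemma universal_threeI:
  assumes "\<And>n. n > 0 \<Longrightarrow> \<exists>x y z. polygonal m x + polygonal m y + polygonal m z = n"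
  shows "universal m (replicate (Suc 2) 1)"
  unfolding universal_replicate_one_iff
proof (intro allI impI)
  fix n :: int assume "n > 0"
  then obtain x y z where "polygonal m x + polygonal m y + polygonal m z = n" using assms by blast
  then show "\<exists>x. length x = Suc 2 \<and> (\<Sum>z\<leftarrow>x. polygonal m z) = n"
    by (intro exI[of _ "[x, y, z]"]) simp
qed

lemma universal_fourI:
  assumes "\<And>n. n > 0 \<Longrightarrow> \<exists>x y z w. polygonal m x + polygonal m y + polygonal m z + polygonal m w = n"
  shows "universal m (replicate (Suc 3) 1)"
  unfolding universal_replicate_one_iff
proof (intro allI impI)
  fix n :: int assume "n > 0"
  then obtain x y z w where "polygonal m x + polygonal m y + polygonal m z + polygonal m w = n"
    using assms by blast
  then show "\<exists>x. length x = Suc 3 \<and> (\<Sum>z\<leftarrow>x. polygonal m z) = n"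
    by (intro exI[of _ "[x, y, z, w]"]) simp
qed

lemma not_universal_twoI:
  assumes "\<And>x y. polygonal m x + polygonal m y \<noteq> n" "n > 0"
  shows "\<not> universal m (replicate 2 1)"
proof
  assume "universal m (replicate 2 1)"
  then obtain x where x: "length x = 2" "(\<Sum>z\<leftarrow>x. polygonal m z) = n"
    using assms(2) unfolding universal_replicate_one_iff by blast
  then obtain y z where "x = [y, z]" by (auto simp: numeral_eq_Suc length_Suc_conv)
  then show False using x(2) assms(1)[of y z] by simp
qed

lemma not_universal_threeI:
  assumes "\<And>x y z. polygonal m x + polygonal m y + polygonal m z \<noteq> n" "n > 0"
  shows "\<not> universal m (replicate 3 1)"
proof
  assume "universal m (replicate 3 1)"
  then obtain x where x: "length x = 3" "(\<Sum>z\<leftarrow>x. polygonal m z) = n"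
    using assms(2) unfolding universal_replicate_one_iff by blast
  then obtain y z w where "x = [y, z, w]" by (auto simp: numeral_eq_Suc length_Suc_conv)
  then show False using x(2) assms(1)[of y z w] by simp
qed

section \<open>Triangular numbers: m = 3 and m = 6\<close>

text \<open>Odd squares are the numbers \<open>8 * tri p + 1\<close>, so
  \<open>three_odd_squares\<close> is applied to \<open>8 * n + 3\<close>.\<close>

lemma three_triangulars:
  fixes n :: int
  assumes "n \<ge> 0"
  obtains p q s where "tri p + tri q + tri s = n"
proof -
  have "(8 * n + 3) mod 8 = 3" "8 * n + 3 > 0" using assms by presburger+
  then obtain u v w where o: "odd u" "odd v" "odd w" and n: "8 * n + 3 = u\<^sup>2 + v\<^sup>2 + w\<^sup>2"
    by (rule three_odd_squares)
  have "\<exists>p. u\<^sup>2 = 8 * tri p + 1" if u: "odd u" for u :: int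
  proof -
    obtain p where "u = 2 * p + 1" using u by (elim oddE)
    then have "u\<^sup>2 = 4 * (2 * tri (p + 1)) + 1"
      unfolding two_times_tri by (simp add: power2_eq_square algebra_simps)
    then show ?thesis by (intro exI[of _ "p + 1"]) simp
  qed
  then obtain p q s where "u\<^sup>2 = 8 * tri p + 1" "v\<^sup>2 = 8 * tri q + 1" "w\<^sup>2 = 8 * tri s + 1"
    using o by metis
  then show ?thesis using n that[of p q s] by simp
qed

lemma tri_cases: "tri x \<in> {0, 1, 3} \<or> tri x \<ge> 6"
proof -
  consider "x \<ge> 4" | "x \<le> -3" | "x \<in> {-2, -1, 0, 1, 2, 3}" by force
  then show ?thesis
  proof cases
    case 1
    then have "4 * 3 \<le> x * (x - 1)" by (intro mult_mono) auto
    then show ?thesis using two_times_tri[of x] by simp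
  next
    case 2
    then have "3 * 4 \<le> (- x) * (1 - x)" by (intro mult_mono) auto
    then show ?thesis using two_times_tri[of x] by (simp add: algebra_simps)
  qed auto
qed

lemma two_tri_neq_5: "tri x + tri y \<noteq> 5"
proof -
  have "s + t \<noteq> 5" if "s \<in> {0, 1, 3} \<or> s \<ge> 6" "t \<in> {0, 1, 3} \<or> t \<ge> 6" for s t :: int
    using that by auto
  then show ?thesis using tri_cases by blast
qed

lemma polygonal_3: "polygonal 3 x = tri (x + 1)"
proof -
  have "2 * polygonal 3 x = 2 * tri (x + 1)"
    unfolding two_times_polygonal two_times_tri by (simp add: power2_eq_square algebra_simps)
  then show ?thesis by simp
qed

lemma polygonal_6: "polygonal 6 x = tri (2 * x)"
proof -
  have "2 * polygonal 6 x = 2 * tri (2 * x)"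
    unfolding two_times_polygonal two_times_tri by (simp add: power2_eq_square algebra_simps)
  then show ?thesis by simp
qed

lemma ell_3: "ell 3 = 3"
proof -
  have "universal 3 (replicate (Suc 2) 1)"
  proof (rule universal_threeI)
    fix n :: int assume "n > 0"
    then obtain p q s where "tri p + tri q + tri s = n" using three_triangulars[of n] by auto
    then show "\<exists>x y z. polygonal 3 x + polygonal 3 y + polygonal 3 z = n"
      by (intro exI[of _ "p - 1"] exI[of _ "q - 1"] exI[of _ "s - 1"]) (simp add: polygonal_3)
  qed
  moreover have "\<not> universal 3 (replicate 2 1)"
    by (rule not_universal_twoI[where n = 5]) (simp_all add: polygonal_3 two_tri_neq_5)
  ultimately show ?thesis using ell_eqI[of 3 2] by simp
qed

lemma ell_6: "ell 6 = 3"
proof -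
  \<comment> \<open>Either \<open>p\<close> or \<open>1 - p\<close> is even, and \<open>tri\<close>
    agrees on them.\<close>
  have "\<exists>x. tri p = tri (2 * x)" for p
  proof (cases "even p")
    case False
    have "tri p = tri (1 - p)" using two_times_tri[of p] two_times_tri[of "1 - p"] by (simp add: algebra_simps)
    moreover obtain x where "1 - p = 2 * x" using False by (metis evenE odd_even_add odd_one diff_conv_add_uminus even_minus)
    ultimately show ?thesis by metis
  qed (auto elim: evenE)
  then have t: "\<exists>x. polygonal 6 x = tri p" for p by (metis polygonal_6)
  have "universal 6 (replicate (Suc 2) 1)"
  proof (rule universal_threeI)
    fix n :: int assume "n > 0"
    then obtain p q s where "tri p + tri q + tri s = n" using three_triangulars[of n] by auto
    moreover obtain x y z where "polygonal 6 x = tri p" "polygonal 6 y = tri q" "polygonal 6 z = tri s"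
      using t by metis
    ultimately show "\<exists>x y z. polygonal 6 x + polygonal 6 y + polygonal 6 z = n" by metis
  qed
  moreover have "\<not> universal 6 (replicate 2 1)"
    by (rule not_universal_twoI[where n = 5]) (simp_all add: polygonal_6 two_tri_neq_5)
  ultimately show ?thesis using ell_eqI[of 6 2] by simp
qed

section \<open>Squares modulo 3 and m = 5\<close>

lemma square_mod_3: "x\<^sup>2 mod 3 = (if 3 dvd x then 0 else 1)" for x :: int
proof (cases "3 dvd x")
  case False
  then have "\<exists>k. x = 3 * k + 1 \<or> x = 3 * k - 1" by presburger
  then obtain k where "x = 3 * k + 1 \<or> x = 3 * k - 1" by blast
  then have "x\<^sup>2 = 3 * (3 * k\<^sup>2 + 2 * k) + 1 \<or> x\<^sup>2 = 3 * (3 * k\<^sup>2 - 2 * k) + 1"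
    by (elim disjE; hypsubst; simp add: power2_eq_square algebra_simps)
  then obtain j where "x\<^sup>2 = 3 * j + 1" by blast
  then have "x\<^sup>2 mod 3 = 1" by simp
  then show ?thesis using False by simp
qed (auto simp: power_mult_distrib)

text \<open>Reflecting \<open>(3 a, 3 b, 3 c)\<close> in the plane orthogonal to \<open>(1, 1, 1)\<close> yields coordinates
  that are all congruent to \<open>a + b + c\<close> modulo 3.\<close>

lemma nine_times_three_squares:
  fixes a b c :: int
  assumes "a\<^sup>2 + b\<^sup>2 + c\<^sup>2 \<noteq> 0"
  shows "\<exists>p q s. \<not> 3 dvd p \<and> \<not> 3 dvd q \<and> \<not> 3 dvd s \<and> 9 * (a\<^sup>2 + b\<^sup>2 + c\<^sup>2) = p\<^sup>2 + q\<^sup>2 + s\<^sup>2"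
proof -
  have reflect: "\<exists>p q s. \<not> 3 dvd p \<and> \<not> 3 dvd q \<and> \<not> 3 dvd s \<and> 9 * (a\<^sup>2 + b\<^sup>2 + c\<^sup>2) = p\<^sup>2 + q\<^sup>2 + s\<^sup>2"
    if "\<not> (3 dvd a \<and> 3 dvd b \<and> 3 dvd c)" for a b c :: int
  proof -
    \<comment> \<open>If 3 divided all three, it would divide \<open>2 * b\<close> and
      \<open>2 * c\<close>, hence also \<open>a\<close>.\<close>
    have "\<not> 3 dvd a + b + c \<or> \<not> 3 dvd a + b + (-c) \<or> \<not> 3 dvd a + (-b) + c" using that by presburger
    then obtain b' c' where *: "b'\<^sup>2 = b\<^sup>2" "c'\<^sup>2 = c\<^sup>2" "\<not> 3 dvd a + b' + c'"
      by (metis power2_minus)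
    define t where "t = a + b' + c'"
    have "9 * (a\<^sup>2 + b'\<^sup>2 + c'\<^sup>2) = (3 * a - 2 * t)\<^sup>2 + (3 * b' - 2 * t)\<^sup>2 + (3 * c' - 2 * t)\<^sup>2"
      by (simp add: t_def power2_eq_square algebra_simps)
    moreover have "\<not> 3 dvd 3 * x - 2 * t" for x
      using *(3) unfolding t_def[symmetric] by presburger
    ultimately show ?thesis using * by metis
  qed
  show ?thesis
    using assms
  proof (induction "nat (a\<^sup>2 + b\<^sup>2 + c\<^sup>2)" arbitrary: a b c rule: less_induct)
    case less
    show ?case
    proof (cases "3 dvd a \<and> 3 dvd b \<and> 3 dvd c")
      case True
      then obtain x y z where abc: "a = 3 * x" "b = 3 * y" "c = 3 * z" by (auto elim!: dvdE)
      then have s: "a\<^sup>2 + b\<^sup>2 + c\<^sup>2 = 9 * (x\<^sup>2 + y\<^sup>2 + z\<^sup>2)" by (simp add: power_mult_distrib)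
      have pos: "x\<^sup>2 + y\<^sup>2 + z\<^sup>2 \<noteq> 0" "x\<^sup>2 + y\<^sup>2 + z\<^sup>2 \<ge> 0" using less.prems unfolding s by auto
      have "nat t < nat (9 * t)" if "t \<noteq> 0" "t \<ge> 0" for t :: int
        using that by (auto simp: nat_less_eq_zless)
      from this[OF pos] have "nat (x\<^sup>2 + y\<^sup>2 + z\<^sup>2) < nat (a\<^sup>2 + b\<^sup>2 + c\<^sup>2)" unfolding s .
      from less.hyps[OF this pos(1)] obtain p q r
        where p: "\<not> 3 dvd p" and pqr: "9 * (x\<^sup>2 + y\<^sup>2 + z\<^sup>2) = p\<^sup>2 + q\<^sup>2 + r\<^sup>2" by metis
      \<comment> \<open>The induction hypothesis yields a representation with a root prime to 3, to
        which the reflection applies.\<close>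
      show ?thesis unfolding s pqr by (rule reflect) (simp add: p)
    qed (rule reflect)
  qed
qed

text \<open>Completing the square reduces the claim to writing \<open>24 * n + 3\<close> as three
  squares prime to 6. Two terms fail at 11.\<close>

lemma ell_5: "ell 5 = 3"
proof -
  have P: "24 * polygonal 5 x + 1 = (6 * x - 1)\<^sup>2" for x
    using two_times_polygonal[of 5 x] by (simp add: power2_eq_square algebra_simps)
  have "\<exists>x. u\<^sup>2 = 24 * polygonal 5 x + 1" if "odd u" "\<not> 3 dvd u" for u :: int
  proof -
    have "6 dvd u + 1 \<or> 6 dvd (-u) + 1" using that by presburger
    then obtain u' x where "u'\<^sup>2 = u\<^sup>2" "u' + 1 = 6 * x" by (metis dvdE power2_minus)
    moreover from this have "u' = 6 * x - 1" by simp
    ultimately show ?thesis using P by metis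
  qed
  note pent = this
  have "universal 5 (replicate (Suc 2) 1)"
  proof (rule universal_threeI)
    fix n :: int assume "n > 0"
    have "(24 * n + 3) mod 8 = 3" "24 * n + 3 > 0" using \<open>n > 0\<close> by presburger+
    then obtain u v w where o: "odd u" "odd v" "odd w" and n: "24 * n + 3 = u\<^sup>2 + v\<^sup>2 + w\<^sup>2"
      by (rule three_odd_squares)
    \<comment> \<open>The sum is divisible by 3, so 3 divides either all three roots or
      none.\<close>
    have "\<exists>u v w. odd u \<and> odd v \<and> odd w \<and> \<not> 3 dvd u \<and> \<not> 3 dvd v \<and> \<not> 3 dvd w \<and>
        24 * n + 3 = u\<^sup>2 + v\<^sup>2 + w\<^sup>2"
    proof (cases "3 dvd u \<and> 3 dvd v \<and> 3 dvd w")
      case True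
      then obtain x y z where uvw: "u = 3 * x" "v = 3 * y" "w = 3 * z" by (auto elim!: dvdE)
      have n9: "24 * n + 3 = 9 * (x\<^sup>2 + y\<^sup>2 + z\<^sup>2)" using n by (simp add: uvw power_mult_distrib)
      then have "x\<^sup>2 + y\<^sup>2 + z\<^sup>2 \<noteq> 0" using \<open>n > 0\<close> by simp
      from nine_times_three_squares[OF this] obtain p q r
        where *: "\<not> 3 dvd p" "\<not> 3 dvd q" "\<not> 3 dvd r" "24 * n + 3 = p\<^sup>2 + q\<^sup>2 + r\<^sup>2"
        using n9 by metis
      \<comment> \<open>The new roots may lose their parity; the sum being 3 modulo 4 forces all
        three to be odd.\<close>
      have sq: "x\<^sup>2 mod 4 = (if even x then 0 else 1)" for x :: int
      proof (cases "even x")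
        case False
        have "y mod 4 = 1" if "y mod 8 = 1" for y :: int using that by presburger
        from this[OF odd_square_mod_8[OF False]] False show ?thesis by simp
      qed (auto elim!: evenE simp: power_mult_distrib)
      have "(p\<^sup>2 mod 4 + q\<^sup>2 mod 4 + r\<^sup>2 mod 4) mod 4 = (p\<^sup>2 + q\<^sup>2 + r\<^sup>2) mod 4"
        by (intro mod_add_cong mod_mod_trivial)
      also have "\<dots> = 3" unfolding *(4)[symmetric] by presburger
      finally have "odd p \<and> odd q \<and> odd r"
        by (cases "odd p"; cases "odd q"; cases "odd r") (simp_all add: sq)
      then show ?thesis using * by blast
    next
      case False
      have "(u\<^sup>2 mod 3 + v\<^sup>2 mod 3 + w\<^sup>2 mod 3) mod 3 = (u\<^sup>2 + v\<^sup>2 + w\<^sup>2) mod 3"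
        by (intro mod_add_cong mod_mod_trivial)
      also have "\<dots> = 0" unfolding n[symmetric] by presburger
      finally have "\<not> 3 dvd u \<and> \<not> 3 dvd v \<and> \<not> 3 dvd w"
        using False by (cases "3 dvd u"; cases "3 dvd v"; cases "3 dvd w") (simp_all add: square_mod_3)
      then show ?thesis using o n by blast
    qed
    then obtain u v w where "24 * n + 3 = u\<^sup>2 + v\<^sup>2 + w\<^sup>2"
      "\<exists>x. u\<^sup>2 = 24 * polygonal 5 x + 1" "\<exists>x. v\<^sup>2 = 24 * polygonal 5 x + 1" "\<exists>x. w\<^sup>2 = 24 * polygonal 5 x + 1"
      using pent by blast
    then obtain x y z where "24 * n + 3 = (24 * polygonal 5 x + 1) + (24 * polygonal 5 y + 1) + (24 * polygonal 5 z + 1)"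
      by metis
    then have "polygonal 5 x + polygonal 5 y + polygonal 5 z = n" by simp
    then show "\<exists>x y z. polygonal 5 x + polygonal 5 y + polygonal 5 z = n" by blast
  qed
  moreover have "\<not> universal 5 (replicate 2 1)"
  proof (rule not_universal_twoI)
    have "polygonal 5 x \<in> {0, 1, 2, 5, 7} \<or> polygonal 5 x \<ge> 12" for x
    proof -
      consider "x \<ge> 3" | "x \<le> -3" | "x \<in> {-2, -1, 0, 1, 2}" by force
      then show ?thesis
      proof cases
        case 1
        then have "3 * 8 \<le> x * (3 * x - 1)" by (intro mult_mono) auto
        then show ?thesis using two_times_polygonal[of 5 x] by (simp add: power2_eq_square algebra_simps)
      next
        case 2
        then have "3 * 10 \<le> (- x) * (1 - 3 * x)" by (intro mult_mono) auto
        then show ?thesis using two_times_polygonal[of 5 x] by (simp add: power2_eq_square algebra_simps)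
      qed (auto simp: polygonal_def)
    qed
    note vals = this
    show "polygonal 5 x + polygonal 5 y \<noteq> 11" for x y
      using vals[of x] vals[of y] by auto
  qed simp
  ultimately show ?thesis using ell_eqI[of 5 2] by simp
qed

section \<open>Four squares and m = 4\<close>

text \<open>This is \<open>cauchy_lemma\<close> with \<open>B = 1\<close>, the sum of squares being
  \<open>2 * T + B\<close>.\<close>

lemma four_squares_with_odd_sum:
  fixes N :: int
  assumes "N > 0" "odd N"
  obtains x1 x2 x3 x4 where "N = x1\<^sup>2 + x2\<^sup>2 + x3\<^sup>2 + x4\<^sup>2" "x1 + x2 + x3 + x4 = 1"
proof -
  obtain T where T: "N = 2 * T + 1" using assms(2) by (elim oddE)
  have "odd (1 :: int)" "(1 - 2)\<^sup>2 \<le> 8 * T + 4" using assms(1) T by simp_all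
  then obtain x1 x2 x3 x4 where x: "tri x1 + tri x2 + tri x3 + tri x4 = T" "x1 + x2 + x3 + x4 = 1"
    by (rule cauchy_lemma)
  have sq: "x\<^sup>2 = 2 * tri x + x" for x
    using two_times_tri[of x] by (simp add: power2_eq_square algebra_simps)
  have "x1\<^sup>2 + x2\<^sup>2 + x3\<^sup>2 + x4\<^sup>2 = N" unfolding sq T using x by linarith
  then show ?thesis using x(2) by (intro that[of x1 x2 x3 x4]) simp_all
qed

lemma four_squares:
  fixes N :: int
  assumes "N \<ge> 0"
  shows "\<exists>x1 x2 x3 x4. N = x1\<^sup>2 + x2\<^sup>2 + x3\<^sup>2 + x4\<^sup>2"
  using assms
proof (induction "nat N" arbitrary: N rule: less_induct)
  case less
  consider "N = 0" | "N > 0" "odd N" | "N > 0" "even N" using less.prems by linarith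
  then show ?case
  proof cases
    case 1
    then show ?thesis by (intro exI[of _ 0]) simp
  next
    case 2
    then show ?thesis by (rule four_squares_with_odd_sum) blast
  next
    case 3
    then obtain M where M: "N = 2 * M" by (elim evenE)
    then obtain x1 x2 x3 x4 where "M = x1\<^sup>2 + x2\<^sup>2 + x3\<^sup>2 + x4\<^sup>2"
      using less.hyps[of M] 3 by auto
    then have "N = (x1 + x2)\<^sup>2 + (x1 - x2)\<^sup>2 + (x3 + x4)\<^sup>2 + (x3 - x4)\<^sup>2"
      unfolding M by (simp add: power2_eq_square algebra_simps)
    then show ?thesis by blast
  qed
qed

lemma ell_4: "ell 4 = 4"
proof -
  have P: "polygonal 4 x = x\<^sup>2" for x
    using two_times_polygonal[of 4 x] by simp
  have "universal 4 (replicate (Suc 3) 1)"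
    by (rule universal_fourI) (metis P four_squares order_less_imp_le)
  moreover have "\<not> universal 4 (replicate 3 1)"
  proof (rule not_universal_threeI)
    have "x\<^sup>2 \<in> {0, 1, 4} \<or> x\<^sup>2 \<ge> 9" for x :: int
    proof -
      consider "\<bar>3\<bar> \<le> \<bar>x\<bar>" | "x \<in> {-2, -1, 0, 1, 2}" by force
      then show ?thesis unfolding abs_le_square_iff by cases auto
    qed
    note vals = this
    show "polygonal 4 x + polygonal 4 y + polygonal 4 z \<noteq> 7" for x y z
      using vals[of x] vals[of y] vals[of z] unfolding P by auto
  qed simp
  ultimately show ?thesis using ell_eqI[of 4 3] by simp
qed

section \<open>Four squares prime to 3 and m = 8\<close>

text \<open>Modulo 3, either one or all four roots are prime to 3. In the first case the other
  squares sum to 9 times a sum of three squares, nonzero by assumption, which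
  \<open>nine_times_three_squares\<close> rewrites.\<close>

lemma four_squares_coprime_to_3:
  fixes x1 x2 x3 x4 :: int
  assumes "(x1\<^sup>2 + x2\<^sup>2 + x3\<^sup>2 + x4\<^sup>2) mod 3 = 1"
    and "x1\<^sup>2 + x2\<^sup>2 + x3\<^sup>2 \<noteq> 0" "x1\<^sup>2 + x2\<^sup>2 + x4\<^sup>2 \<noteq> 0" "x1\<^sup>2 + x3\<^sup>2 + x4\<^sup>2 \<noteq> 0" "x2\<^sup>2 + x3\<^sup>2 + x4\<^sup>2 \<noteq> 0"
  shows "\<exists>y1 y2 y3 y4. \<not> 3 dvd y1 \<and> \<not> 3 dvd y2 \<and> \<not> 3 dvd y3 \<and> \<not> 3 dvd y4 \<and>
    x1\<^sup>2 + x2\<^sup>2 + x3\<^sup>2 + x4\<^sup>2 = y1\<^sup>2 + y2\<^sup>2 + y3\<^sup>2 + y4\<^sup>2"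
proof -
  have *: "\<exists>y1 y2 y3. \<not> 3 dvd y1 \<and> \<not> 3 dvd y2 \<and> \<not> 3 dvd y3 \<and> a\<^sup>2 + b\<^sup>2 + c\<^sup>2 = y1\<^sup>2 + y2\<^sup>2 + y3\<^sup>2"
    if h: "3 dvd a" "3 dvd b" "3 dvd c" "a\<^sup>2 + b\<^sup>2 + c\<^sup>2 \<noteq> 0" for a b c :: int
  proof -
    obtain x y z where abc: "a = 3 * x" "b = 3 * y" "c = 3 * z" using h by (auto elim!: dvdE)
    then have s: "a\<^sup>2 + b\<^sup>2 + c\<^sup>2 = 9 * (x\<^sup>2 + y\<^sup>2 + z\<^sup>2)" by (simp add: power_mult_distrib)
    then show ?thesis using nine_times_three_squares[of x y z] h(4) by simp
  qed
  consider "\<not> 3 dvd x1" "\<not> 3 dvd x2" "\<not> 3 dvd x3" "\<not> 3 dvd x4"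
    | "3 dvd x1" "3 dvd x2" "3 dvd x3" "\<not> 3 dvd x4"
    | "3 dvd x1" "3 dvd x2" "3 dvd x4" "\<not> 3 dvd x3"
    | "3 dvd x1" "3 dvd x3" "3 dvd x4" "\<not> 3 dvd x2"
    | "3 dvd x2" "3 dvd x3" "3 dvd x4" "\<not> 3 dvd x1"
  proof -
    have "(x1\<^sup>2 mod 3 + x2\<^sup>2 mod 3 + x3\<^sup>2 mod 3 + x4\<^sup>2 mod 3) mod 3 =
        (x1\<^sup>2 + x2\<^sup>2 + x3\<^sup>2 + x4\<^sup>2) mod 3"
      by (intro mod_add_cong mod_mod_trivial)
    also note assms(1)
    finally show ?thesis
      by (cases "3 dvd x1"; cases "3 dvd x2"; cases "3 dvd x3"; cases "3 dvd x4")
         (use that in \<open>simp_all add: square_mod_3\<close>)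
  qed
  then show ?thesis
  proof cases
    case 2
    obtain y1 y2 y3 where "\<not> 3 dvd y1" "\<not> 3 dvd y2" "\<not> 3 dvd y3"
      "x1\<^sup>2 + x2\<^sup>2 + x3\<^sup>2 = y1\<^sup>2 + y2\<^sup>2 + y3\<^sup>2" using 2 *[of x1 x2 x3] assms(2) by blast
    then show ?thesis using 2 by (intro exI[of _ y1] exI[of _ y2] exI[of _ y3] exI[of _ x4]) simp
  next
    case 3
    obtain y1 y2 y3 where "\<not> 3 dvd y1" "\<not> 3 dvd y2" "\<not> 3 dvd y3"
      "x1\<^sup>2 + x2\<^sup>2 + x4\<^sup>2 = y1\<^sup>2 + y2\<^sup>2 + y3\<^sup>2" using 3 *[of x1 x2 x4] assms(3) by blast
    then show ?thesis using 3 by (intro exI[of _ y1] exI[of _ y2] exI[of _ y3] exI[of _ x3]) simp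
  next
    case 4
    obtain y1 y2 y3 where "\<not> 3 dvd y1" "\<not> 3 dvd y2" "\<not> 3 dvd y3"
      "x1\<^sup>2 + x3\<^sup>2 + x4\<^sup>2 = y1\<^sup>2 + y2\<^sup>2 + y3\<^sup>2" using 4 *[of x1 x3 x4] assms(4) by blast
    then show ?thesis using 4 by (intro exI[of _ y1] exI[of _ y2] exI[of _ y3] exI[of _ x2]) simp
  next
    case 5
    obtain y1 y2 y3 where "\<not> 3 dvd y1" "\<not> 3 dvd y2" "\<not> 3 dvd y3"
      "x2\<^sup>2 + x3\<^sup>2 + x4\<^sup>2 = y1\<^sup>2 + y2\<^sup>2 + y3\<^sup>2" using 5 *[of x2 x3 x4] assms(5) by blast
    then show ?thesis using 5 by (intro exI[of _ y1] exI[of _ y2] exI[of _ y3] exI[of _ x1]) simp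
  qed blast
qed

text \<open>Three vanishing roots must be avoided. For odd \<open>N\<close>, roots with sum 1 would
  then give \<open>N = 1\<close>; for an even nonsquare it cannot happen; an even square is
  \<open>4 * e\<^sup>2\<close>, four equal squares.\<close>

lemma ex_four_squares_coprime_to_3:
  fixes N :: int
  assumes "N mod 3 = 1" "N > 1"
  shows "\<exists>y1 y2 y3 y4. \<not> 3 dvd y1 \<and> \<not> 3 dvd y2 \<and> \<not> 3 dvd y3 \<and> \<not> 3 dvd y4 \<and>
    N = y1\<^sup>2 + y2\<^sup>2 + y3\<^sup>2 + y4\<^sup>2"
proof -
  have zero: "a\<^sup>2 + b\<^sup>2 + c\<^sup>2 = 0 \<longleftrightarrow> a = 0 \<and> b = 0 \<and> c = 0" for a b c :: int
    by (metis add_nonneg_eq_0_iff zero_le_power2 power2_eq_iff_nonneg zero_eq_power2 add_nonneg_nonneg)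
  show ?thesis
  proof (cases "odd N \<or> \<not> (\<exists>d. N = d\<^sup>2)")
    case True
    obtain x1 x2 x3 x4 where N: "N = x1\<^sup>2 + x2\<^sup>2 + x3\<^sup>2 + x4\<^sup>2" and x: "odd N \<Longrightarrow> x1 + x2 + x3 + x4 = 1"
    proof (cases "odd N")
      case True
      have "N > 0" using assms(2) by simp
      then show ?thesis using True by (rule four_squares_with_odd_sum) (rule that, assumption+)
    next
      case False
      then have "odd N \<Longrightarrow> x1 + x2 + x3 + x4 = 1" for x1 x2 x3 x4 :: int by simp
      then show ?thesis using four_squares[of N] assms(2) that by fastforce
    qed
    have "\<not> (\<exists>d. N = d\<^sup>2 \<and> (odd N \<longrightarrow> d = 1))" using True assms(2) by auto
    then show ?thesis
      using assms(1) x unfolding N by (intro four_squares_coprime_to_3) (auto simp: zero)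
  next
    case False
    then obtain d where d: "N = d\<^sup>2" "even d" by auto
    then obtain e where e: "d = 2 * e" by (elim evenE)
    have N: "N = e\<^sup>2 + e\<^sup>2 + e\<^sup>2 + e\<^sup>2" by (simp add: d e power_mult_distrib)
    have "\<not> 3 dvd e" using assms(1) unfolding N by (auto elim!: dvdE simp: power_mult_distrib)
    then show ?thesis using N by blast
  qed
qed

text \<open>Completing the square reduces the claim to four squares prime to 3 with sum
  \<open>3 * n + 4\<close>. Three terms fail at 4, as only 0 and 1 lie below 5.\<close>

lemma ell_8: "ell 8 = 4"
proof -
  have P: "3 * polygonal 8 x + 1 = (3 * x - 1)\<^sup>2" for x
    using two_times_polygonal[of 8 x] by (simp add: power2_eq_square algebra_simps)
  have oct: "\<exists>x. y\<^sup>2 = 3 * polygonal 8 x + 1" if "\<not> 3 dvd y" for y :: int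
  proof -
    have "3 dvd y + 1 \<or> 3 dvd (-y) + 1" using that by presburger
    then obtain y' x where "y'\<^sup>2 = y\<^sup>2" "y' + 1 = 3 * x" by (metis dvdE power2_minus)
    moreover from this have "y' = 3 * x - 1" by simp
    ultimately show ?thesis using P by metis
  qed
  have "universal 8 (replicate (Suc 3) 1)"
  proof (rule universal_fourI)
    fix n :: int assume "n > 0"
    then have "(3 * n + 4) mod 3 = 1" "3 * n + 4 > 1" by presburger+
    from ex_four_squares_coprime_to_3[OF this] obtain y1 y2 y3 y4 where
      y: "\<not> 3 dvd y1" "\<not> 3 dvd y2" "\<not> 3 dvd y3" "\<not> 3 dvd y4" "3 * n + 4 = y1\<^sup>2 + y2\<^sup>2 + y3\<^sup>2 + y4\<^sup>2"
      by blast
    obtain x1 where "y1\<^sup>2 = 3 * polygonal 8 x1 + 1" using oct y by blast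
    moreover obtain x2 where "y2\<^sup>2 = 3 * polygonal 8 x2 + 1" using oct y by blast
    moreover obtain x3 where "y3\<^sup>2 = 3 * polygonal 8 x3 + 1" using oct y by blast
    moreover obtain x4 where "y4\<^sup>2 = 3 * polygonal 8 x4 + 1" using oct y by blast
    ultimately have "polygonal 8 x1 + polygonal 8 x2 + polygonal 8 x3 + polygonal 8 x4 = n"
      using y(5) by linarith
    then show "\<exists>x y z w. polygonal 8 x + polygonal 8 y + polygonal 8 z + polygonal 8 w = n" by blast
  qed
  moreover have "\<not> universal 8 (replicate 3 1)"
  proof (rule not_universal_threeI)
    show "polygonal 8 x + polygonal 8 y + polygonal 8 z \<noteq> 4" for x y z
      using polygonal_cases[of 8 x] polygonal_cases[of 8 y] polygonal_cases[of 8 z] by auto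
  qed simp
  ultimately show ?thesis using ell_eqI[of 8 3] by simp
qed

section \<open>The minimal lengths\<close>

theorem theorem1p1:
  fixes m :: int and r :: nat
  assumes "m \<ge> 3"
  shows
    "(m \<notin> {7, 9} \<longrightarrow>
        (m \<ge> 10 \<longrightarrow> int (ell m) = m - 4) \<and>
        (m \<in> {3, 5, 6} \<longrightarrow> ell m = 3) \<and>
        (m \<in> {4, 8} \<longrightarrow> ell m = 4)) \<and>
     (7 \<le> r \<and> int r < m - 3 \<longrightarrow>
        int (ell_rep m r (r - 1)) = \<lceil>real_of_int (m - 3) / real r\<rceil> + (int r - 2)) \<and>
     (m \<ge> 14 \<longrightarrow> int (ell_rep m 2 1) = \<lfloor>real_of_int m / 2\<rfloor>) \<and>
     (m \<ge> 10 \<and> m mod 3 \<noteq> 2 \<longrightarrow> int (ell_rep m 3 2) = m - 2) \<and>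
     (m \<ge> 14 \<and> m mod 3 = 2 \<longrightarrow> real (ell_rep m 3 2) = real_of_int (2 * m - 4) / 3) \<and>
     (m \<ge> 62 \<longrightarrow> int (ell_rep m 4 3) = \<lceil>real_of_int (m - 2) / 4\<rceil> + 2) \<and>
     (m \<ge> 78 \<longrightarrow> int (ell_rep m 5 4) = \<lceil>real_of_int (m - 3) / 5\<rceil> + 3) \<and>
     (m \<ge> 93 \<longrightarrow> int (ell_rep m 6 5) = \<lceil>real_of_int (m - 3) / 6\<rceil> + 4)"
proof -
  have 1: "m \<notin> {7, 9} \<longrightarrow>
        (m \<ge> 10 \<longrightarrow> int (ell m) = m - 4) \<and>
        (m \<in> {3, 5, 6} \<longrightarrow> ell m = 3) \<and>
        (m \<in> {4, 8} \<longrightarrow> ell m = 4)"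
    using ell_eq ell_3 ell_4 ell_5 ell_6 ell_8 by auto
  have 2: "int (ell_rep m r (r - 1)) = \<lceil>real_of_int (m - 3) / real r\<rceil> + (int r - 2)"
    if "7 \<le> r \<and> int r < m - 3"
    using that by (intro ell_rep_eq_ceiling universal_large_coefficient) auto
  \<comment> \<open>Here only four ones are present, one fewer than
    \<open>universal_large_coefficient\<close> relies on.\<close>
  have 5: "int (ell_rep m 5 4) = \<lceil>real_of_int (m - 3) / 5\<rceil> + 3" if "m \<ge> 78"
    using ell_rep_eq_ceiling[of 5 m] universal_fives[of _ m] that by simp
  have 6: "int (ell_rep m 6 5) = \<lceil>real_of_int (m - 3) / 6\<rceil> + 4" if "m \<ge> 93"
    using ell_rep_eq_ceiling[of 6 m] universal_large_coefficient[of 6 m] that by simp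
  show ?thesis
    using 1 2 5 6 ell_rep_2 ell_rep_3_long ell_rep_3_short ell_rep_4 by blast
qed

end
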